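(* Let $n\geq1$ and let $\vec{p_1}=(p_{11},\dots,p_{1n})$, $\vec{p_2}=(p_{21},\dots,p_{2n})$, $\vec{q}=(q_1,\dots,q_n)$ satisfy, for every $i=1,\dots,n$: $1<p_{1i}<\infty$, $1<q_i<\infty$, $p_{1i}'<p_{2i}<\infty$ (where $p_{1i}'=\frac{p_{1i}}{p_{1i}-1}$), and $\frac{1}{q_i}=\frac{1}{p_{1i}}+\frac{1}{p_{2i}}$. Let $\lambda,\lambda_1,\lambda_2\in\mathbb{R}$ satisfy $-\frac{1}{n}\sum_{i=1}^{n}\frac{1}{q_i}<\lambda<0$, $0\leq\lambda_2<\frac{1}{n}$ and $\lambda=\lambda_1+\lambda_2$. If $b\in\mathrm{CBMO}^{\vec{p_2},\lambda_2}(\mathbb{R}^n)$, then $\mathcal{H}_b$ is bounded from $\mathcal{B}^{\vec{p_1},\lambda_1}(\mathbb{R}^n)$ to $\mathcal{B}^{\vec{q},\lambda}(\mathbb{R}^n)$, and there is a constant $C>0$ independent of $b$ and $f$ such that for all $f\in\mathcal{B}^{\vec{p_1},\lambda_1}(\mathbb{R}^n)$ $$\|\mathcal{H}_bf\|_{\mathcal{B}^{\vec{q},\lambda}(\mathbb{R}^n)}\leq C\,\|b\|_{\mathrm{CBMO}^{\vec{p_2},\lambda_2}(\mathbb{R}^n)}\|f\|_{\mathcal{B}^{\vec{p_1},\lambda_1}(\mathbb{R}^n)}.$$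
   Context: Functions are complex-valued Lebesgue measurable functions on $\mathbb{R}^n$; $B(0,r)$ is the Euclidean ball centered at the origin with radius $r$; $|E|$ is the Lebesgue measure and $\chi_E$ the characteristic function of $E$. Mixed Lebesgue space: for $\vec{p}=(p_1,\dots,p_n)$ with $0<p_i<\infty$, $$\|f\|_{L^{\vec{p}}(\mathbb{R}^n)}=\Bigg(\int_{\mathbb{R}}\cdots\bigg(\int_{\mathbb{R}}\Big(\int_{\mathbb{R}}|f(x_1,x_2,\dots,x_n)|^{p_1}dx_1\Big)^{\frac{p_2}{p_1}}dx_2\bigg)^{\frac{p_3}{p_2}}\cdots dx_n\Bigg)^{\frac{1}{p_n}},$$ and $L^{\vec{p}}(\mathbb{R}^n)$ is the set of measurable $f$ with $\|f\|_{L^{\vec{p}}(\mathbb{R}^n)}<\infty$. Mixed $\lambda$-central bounded mean oscillation space: for $\vec{q}$ with $1<q_i<\infty$ for all $i$ and $\lambda<\frac1n$, $\mathrm{CBMO}^{\vec{q},\lambda}(\mathbb{R}^n)$ is the set of measurable $f$ with $$\|f\|_{\mathrm{CBMO}^{\vec{q},\lambda}(\mathbb{R}^n)}=\sup_{r>0}\frac{\|(f-f_{B(0,r)})\chi_{B(0,r)}\|_{L^{\vec{q}}(\mathbb{R}^n)}}{|B(0,r)|^{\lambda}\|\chi_{B(0,r)}\|_{L^{\vec{q}}(\mathbb{R}^n)}}<\infty,\qquad f_{B(0,r)}=\frac{1}{|B(0,r)|}\int_{B(0,r)}f(t)\,dt.$$ Mixed $\lambda$-central Morrey space: for $\vec{q}$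 with $1<q_i<\infty$ for all $i$ and $\lambda\in\mathbb{R}$, $\mathcal{B}^{\vec{q},\lambda}(\mathbb{R}^n)$ is the set of measurable $f$ with $$\|f\|_{\mathcal{B}^{\vec{q},\lambda}(\mathbb{R}^n)}=\sup_{r>0}\frac{\|f\chi_{B(0,r)}\|_{L^{\vec{q}}(\mathbb{R}^n)}}{|B(0,r)|^{\lambda}\|\chi_{B(0,r)}\|_{L^{\vec{q}}(\mathbb{R}^n)}}<\infty.$$ Hardy operator: $\mathcal{H}f(x)=\frac{1}{|x|^n}\int_{|t|<|x|}f(t)\,dt$ for $x\in\mathbb{R}^n\setminus\{0\}$. Its commutator with a locally integrable function $b$ is $\mathcal{H}_bf=b\,\mathcal{H}f-\mathcal{H}(fb)$, i.e. $\mathcal{H}_bf(x)=\frac{1}{|x|^n}\int_{|t|<|x|}(b(x)-b(t))f(t)\,dt$. *)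

theory Defs
  imports "HOL-Analysis.Analysis"
begin

text \<open>
  Points of n-dimensional Euclidean space are vectors of type \<open>real ^ 'n\<close>, where
  n is \<open>CARD('n)\<close>. The coordinates are integrated in a fixed order, which is why
  the index type carries a linear order: \<open>sorted_list_of_set UNIV\<close> plays the role of
  the list 1, ..., n. Vectors of exponents are also of type \<open>real ^ 'n\<close>.
  All (quasi-)norms are extended nonnegative, so that they make sense for every measurable
  function, and membership in a space means measurability and finiteness of the norm.
\<close>

text \<open>Only used with a positive exponent \<open>a\<close>.\<close>

definition ennpowr :: "ennreal \<Rightarrow> real \<Rightarrow> ennreal" where
  "ennpowr y a = (if y = \<infinity> then \<infinity> else ennreal (enn2real y powr a))"

definition vec_upd :: "real ^ 'n \<Rightarrow> 'n \<Rightarrow> real \<Rightarrow> real ^ 'n" where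
  "vec_upd x i t = (\<chi> j. if j = i then t else x $ j)"

text \<open>
  \<open>iterated_int p a is G\<close> integrates out the coordinates in \<open>is\<close>, the head of the list
  being the innermost integral. The parameter \<open>a\<close> is the exponent of the coordinate
  integrated previously, so that the integrand is raised to the power \<open>p\<^sub>i / p\<^sub>i\<^sub>-\<^sub>1\<close>;
  after the outermost integral the power \<open>1 / p\<^sub>n\<close> is taken. The initial value of \<open>a\<close>
  is 1, since the innermost integrand is \<open>\<bar>f\<bar>\<close> to the power \<open>p\<^sub>1\<close>.
\<close>

fun iterated_int ::
  "real ^ 'n \<Rightarrow> real \<Rightarrow> 'n list \<Rightarrow> (real ^ 'n \<Rightarrow> ennreal) \<Rightarrow> real ^ 'n \<Rightarrow> ennreal" where
  "iterated_int p a [] G = (\<lambda>x. ennpowr (G x) (1 / a))"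
| "iterated_int p a (i # is) G =
     iterated_int p (p $ i) is
       (\<lambda>x. \<integral>\<^sup>+ t. ennpowr (G (vec_upd x i t)) (p $ i / a) \<partial>lebesgue)"

text \<open>
  All coordinates are integrated out, hence the base point 0 is irrelevant.
\<close>

definition mixed_norm ::
  "real ^ 'n::{finite,linorder} \<Rightarrow> (real ^ 'n::{finite,linorder} \<Rightarrow> complex) \<Rightarrow> ennreal" where
  "mixed_norm p f =
     iterated_int p 1 (sorted_list_of_set UNIV) (\<lambda>x. ennreal (cmod (f x))) 0"

definition ball_mean :: "real \<Rightarrow> (real ^ 'n::finite \<Rightarrow> complex) \<Rightarrow> complex" where
  "ball_mean r f = (LINT t:ball 0 r|lebesgue. f t) /\<^sub>R measure lebesgue (ball (0 :: real ^ 'n) r)"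

text \<open>
  If \<open>f\<close> is not integrable over a ball, then \<open>ball_mean\<close> is 0 by convention of the
  Bochner integral. This does not enlarge the space \<open>cbmo\<close> below: the corresponding quotient
  in \<open>cbmo_norm\<close> is then infinite, because for exponents greater than 1 a finite mixed norm of
  \<open>f\<close> on a ball implies integrability of \<open>f\<close> there.
\<close>

definition cbmo_norm ::
  "real ^ 'n::{finite,linorder} \<Rightarrow> real \<Rightarrow> (real ^ 'n::{finite,linorder} \<Rightarrow> complex) \<Rightarrow> ennreal" where
  "cbmo_norm q l f =
     (SUP r\<in>{0<..}.
        mixed_norm q (\<lambda>x. (f x - ball_mean r f) * indicator (ball 0 r) x) /
        (ennreal (measure lebesgue (ball (0 :: real ^ 'n::{finite,linorder}) r) powr l)
           * mixed_norm q (indicator (ball 0 r))))"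

definition cbmo ::
  "real ^ 'n::{finite,linorder} \<Rightarrow> real \<Rightarrow> (real ^ 'n::{finite,linorder} \<Rightarrow> complex) set" where
  "cbmo q l = {f \<in> borel_measurable lebesgue. cbmo_norm q l f < \<infinity>}"

definition morrey_norm ::
  "real ^ 'n::{finite,linorder} \<Rightarrow> real \<Rightarrow> (real ^ 'n::{finite,linorder} \<Rightarrow> complex) \<Rightarrow> ennreal" where
  "morrey_norm q l f =
     (SUP r\<in>{0<..}.
        mixed_norm q (\<lambda>x. f x * indicator (ball 0 r) x) /
        (ennreal (measure lebesgue (ball (0 :: real ^ 'n::{finite,linorder}) r) powr l)
           * mixed_norm q (indicator (ball 0 r))))"

definition morrey ::
  "real ^ 'n::{finite,linorder} \<Rightarrow> real \<Rightarrow> (real ^ 'n::{finite,linorder} \<Rightarrow> complex) set" where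
  "morrey q l = {f \<in> borel_measurable lebesgue. morrey_norm q l f < \<infinity>}"

text \<open>
  The value of \<open>hardy f\<close> at 0, where the operator is undefined in the literature, is 0 here;
  a single point does not affect any of the norms.
\<close>

definition hardy :: "(real ^ 'n::finite \<Rightarrow> complex) \<Rightarrow> real ^ 'n \<Rightarrow> complex" where
  "hardy f x = (LINT t:ball 0 (norm x)|lebesgue. f t) /\<^sub>R norm x ^ CARD('n)"

text \<open>The integral defining \<open>hardy f\<close> converges absolutely at every point.\<close>

definition hardy_defined :: "(real ^ 'n::finite \<Rightarrow> complex) \<Rightarrow> bool" where
  "hardy_defined f \<longleftrightarrow> (\<forall>x :: real ^ 'n. set_integrable lebesgue (ball 0 (norm x)) f)"

definition hardy_comm ::
  "(real ^ 'n::finite \<Rightarrow> complex) \<Rightarrow> (real ^ 'n \<Rightarrow> complex) \<Rightarrow> real ^ 'n \<Rightarrow> complex" where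
  "hardy_comm b f = (\<lambda>x. b x * hardy f x - hardy (\<lambda>t. f t * b t) x)"

end

theory Submission
  imports Defs
begin

text \<open>
  Cut the ball of radius \<open>r\<close> into the shells \<open>R / 2 \<le> \<bar>x\<bar> < R\<close> with \<open>R = r / 2\<^sup>k\<close>. On such a shell, with
  \<open>c\<close> the mean of \<open>b\<close> over \<open>B(0,R)\<close>, the commutator is at most
  \<open>(2 / R)\<^sup>n (\<bar>b(x) - c\<bar> \<integral>\<bar>f\<bar> + \<integral>\<bar>b - c\<bar>\<bar>f\<bar>)\<close>, both integrals over \<open>B(0,R)\<close>. Holder's inequality for
  mixed norms bounds its norm on the shell by a constant times \<open>\<parallel>b\<parallel> \<parallel>f\<parallel> R\<^sup>e\<close>,
  where \<open>e = n \<lambda> + \<Sum>1/q\<^sub>i > 0\<close>. By Minkowski's inequality these bounds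
  may be summed over the shells, which gives a geometric series.
\<close>

text \<open>Since \<open>c\<close> is the mean over the very ball on which \<open>f\<close> is
  integrated, means over different balls are never compared and only a single series arises. In the
  estimate on one shell the powers of \<open>R\<close> produced by Holder's inequality cancel
  against \<open>R\<close> to the power -n; the exponent \<open>e\<close> comes solely from the
  norms of \<open>b\<close> and \<open>f\<close> on balls. Its positivity is the lower bound assumed
  for lambda, and it makes the shells shrinking to the origin summable. The measure-theoretic
  obstacle is that a Lebesgue measurable function may have non-measurable sections, so one-variable
  inequalities cannot simply be applied coordinate by coordinate. Holder and Minkowski are therefore
  proved for Borel functions and transferred, because changing a function on a null set leaves its
  mixed norm unchanged. An integral over a ball is itself a mixed norm, with all exponents 1, so it
  falls under the same Holder inequality.\<close>

section \<open>Powers of extended nonnegative reals\<close>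

lemma ennpowr_top [simp]: "ennpowr top a = top"
  by (simp add: ennpowr_def)

lemma ennpowr_ennreal: "0 \<le> x \<Longrightarrow> ennpowr (ennreal x) a = ennreal (x powr a)"
  by (simp add: ennpowr_def)

lemma ennpowr_0 [simp]: "ennpowr 0 a = 0"
  by (simp add: ennpowr_def)

lemma ennpowr_one [simp]: "ennpowr x 1 = x"
  by (cases x) (simp_all add: ennpowr_ennreal)

lemma ennpowr_eq_0_iff [simp]: "ennpowr x a = 0 \<longleftrightarrow> x = 0"
  by (cases x) (auto simp: ennpowr_ennreal ennreal_eq_0_iff)

text \<open>No sign condition on the exponents is required: 0 and \<open>top\<close> are fixed
  points of \<open>ennpowr\<close> for every exponent, even a negative one.\<close>

lemma ennpowr_ennpowr: "ennpowr (ennpowr x a) b = ennpowr x (a * b)"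
  by (cases x) (simp_all add: ennpowr_ennreal powr_powr)

lemma ennpowr_mult: "ennpowr (x * y) a = ennpowr x a * ennpowr y a"
  by (cases x; cases y)
     (auto simp: ennpowr_ennreal powr_mult ennreal_mult_top ennreal_top_mult simp flip: ennreal_mult)

lemma ennpowr_mono: "0 < a \<Longrightarrow> x \<le> y \<Longrightarrow> ennpowr x a \<le> ennpowr y a"
  by (cases x; cases y) (auto simp: ennpowr_ennreal powr_mono2 top_unique)

lemma ennpowr_inverse [simp]:
  assumes "a \<noteq> 0"
  shows "ennpowr (ennpowr x a) (1 / a) = x" "ennpowr (ennpowr x (1 / a)) a = x"
  using assms by (simp_all add: ennpowr_ennpowr)

lemma ennpowr_le_iff: "0 < a \<Longrightarrow> ennpowr x (1 / a) \<le> y \<longleftrightarrow> x \<le> ennpowr y a"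
  using ennpowr_mono[of a "ennpowr x (1 / a)" y] ennpowr_mono[of "1 / a" x "ennpowr y a"] by auto

text \<open>For positive \<open>a\<close> the power is an order isomorphism with inverse the power
  \<open>1 / a\<close>, so it commutes with suprema.\<close>

lemma ennpowr_SUP:
  assumes "0 < a"
  shows "ennpowr (SUP n. f n) a = (SUP n. ennpowr (f n) a)"
proof (rule antisym)
  have "(SUP n. f n) \<le> ennpowr (SUP n. ennpowr (f n) a) (1 / a)"
  proof (rule SUP_least)
    fix n
    have "ennpowr (ennpowr (f n) a) (1 / a) \<le> ennpowr (SUP n. ennpowr (f n) a) (1 / a)"
      using assms by (intro ennpowr_mono SUP_upper) auto
    then show "f n \<le> ennpowr (SUP n. ennpowr (f n) a) (1 / a)"
      using assms by simp
  qed
  from ennpowr_mono[OF assms this] show "ennpowr (SUP n. f n) a \<le> (SUP n. ennpowr (f n) a)"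
    using assms by simp
qed (use assms in \<open>auto intro!: SUP_least ennpowr_mono SUP_upper\<close>)

lemma borel_measurable_ennpowr [measurable]:
  assumes [measurable]: "f \<in> borel_measurable M"
  shows "(\<lambda>x. ennpowr (f x) a) \<in> borel_measurable M"
  unfolding ennpowr_def by measurable

section \<open>Holder and Minkowski inequalities in one variable\<close>

text \<open>The weights \<open>q / p\<close> and \<open>q / r\<close> sum to 1, so this is the
  weighted inequality of arithmetic and geometric means for \<open>x powr p\<close> and
  \<open>y powr r\<close>.\<close>

lemma Youngs_inequality_powr:
  fixes x y p r q :: real
  assumes "0 < p" "0 < r" "0 < q" "1 / q = 1 / p + 1 / r" "0 \<le> x" "0 \<le> y"
  shows "(x * y) powr q \<le> q / p * x powr p + q / r * y powr r"
proof (cases "x = 0 \<or> y = 0")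
  case False
  have *: "q / p + q / r = 1"
    using assms(3,4) by (simp add: field_simps)
  have "(x powr p) powr (q / p) * (y powr r) powr (q / r) \<le> q / p * x powr p + q / r * y powr r"
    using False assms * by (intro Youngs_inequality_0) auto
  then show ?thesis
    using assms by (simp add: powr_powr powr_mult)
qed (use assms in auto)

text \<open>For positive \<open>x\<close> and \<open>y\<close> this is convexity on the open
  half-line; if one of them is 0 it reduces to \<open>s powr p \<le> s\<close> for \<open>s\<close>
  below 1.\<close>

lemma powr_convex_nonneg:
  fixes x y p s u :: real
  assumes "1 \<le> p" "0 \<le> x" "0 \<le> y" "0 < s" "0 < u" "s + u = 1"
  shows "(s * x + u * y) powr p \<le> s * x powr p + u * y powr p"
proof -
  have *: "(s * x) powr p \<le> s * x powr p" if "0 < s" "s < 1" "0 \<le> x" for s x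
  proof -
    have "s powr p \<le> s powr 1"
      using that assms by (intro powr_mono') auto
    then show ?thesis
      using that by (simp add: powr_mult mult_right_mono)
  qed
  consider "x = 0" | "y = 0" | "0 < x" "0 < y"
    using assms by linarith
  then show ?thesis
  proof cases
    case 3
    have "s = 1 - u"
      using assms by simp
    with 3 assms convex_onD[OF powr_convex[of p], of u x y] show ?thesis
      by simp
  qed (use assms *[of u y] *[of s x] in auto)
qed

definition lp_norm :: "real \<Rightarrow> 'a measure \<Rightarrow> ('a \<Rightarrow> ennreal) \<Rightarrow> ennreal" where
  "lp_norm p M f = ennpowr (\<integral>\<^sup>+x. ennpowr (f x) p \<partial>M) (1 / p)"

lemma lp_norm_powr: "p \<noteq> 0 \<Longrightarrow> ennpowr (lp_norm p M f) p = (\<integral>\<^sup>+x. ennpowr (f x) p \<partial>M)"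
  by (simp add: lp_norm_def)

lemma lp_norm_mono_AE:
  "0 < p \<Longrightarrow> AE x in M. f x \<le> g x \<Longrightarrow> lp_norm p M f \<le> lp_norm p M g"
  unfolding lp_norm_def
  by (intro ennpowr_mono nn_integral_mono_AE) (auto intro: ennpowr_mono)

lemma lp_norm_mono:
  "0 < p \<Longrightarrow> (\<And>x. x \<in> space M \<Longrightarrow> f x \<le> g x) \<Longrightarrow> lp_norm p M f \<le> lp_norm p M g"
  by (intro lp_norm_mono_AE AE_I2)

lemma lp_norm_1 [simp]: "lp_norm 1 M f = (\<integral>\<^sup>+x. f x \<partial>M)"
  by (simp add: lp_norm_def)

lemma lp_norm_cong_AE: "AE x in M. f x = g x \<Longrightarrow> lp_norm p M f = lp_norm p M g"
  unfolding lp_norm_def by (intro arg_cong2[where f=ennpowr] nn_integral_cong_AE) auto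

lemma lp_norm_cmult:
  assumes "p \<noteq> 0" "f \<in> borel_measurable M"
  shows "lp_norm p M (\<lambda>x. c * f x) = c * lp_norm p M f"
  using assms by (simp add: lp_norm_def ennpowr_mult nn_integral_cmult)

lemma lp_norm_eq_0_iff:
  assumes "f \<in> borel_measurable M"
  shows "lp_norm p M f = 0 \<longleftrightarrow> (AE x in M. f x = 0)"
  using assms by (simp add: lp_norm_def nn_integral_0_iff_AE)

lemma lp_norm_SUP:
  assumes "0 < p" "incseq F" and [measurable]: "\<And>n. F n \<in> borel_measurable M"
  shows "lp_norm p M (\<lambda>x. SUP n. F n x) = (SUP n. lp_norm p M (F n))"
proof -
  have "(\<integral>\<^sup>+x. (SUP n. ennpowr (F n x) p) \<partial>M) = (SUP n. \<integral>\<^sup>+x. ennpowr (F n x) p \<partial>M)"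
    using assms by (intro nn_integral_monotone_convergence_SUP)
      (auto simp: incseq_def le_fun_def intro!: ennpowr_mono)
  then show ?thesis
    using assms by (simp add: lp_norm_def ennpowr_SUP)
qed

text \<open>Normalise both factors to norm 1, apply Young's inequality pointwise and integrate.
  Normalising needs norms \<open>a\<close> and \<open>b\<close> that are neither 0 nor infinite,
  hence the case split.\<close>

lemma lp_norm_Holder:
  assumes "0 < p" "0 < r" "0 < q" "1 / q = 1 / p + 1 / r"
    and [measurable]: "f \<in> borel_measurable M" "g \<in> borel_measurable M"
  shows "lp_norm q M (\<lambda>x. f x * g x) \<le> lp_norm p M f * lp_norm r M g"
proof -
  consider "lp_norm p M f = 0 \<or> lp_norm r M g = 0"
    | "lp_norm p M f \<noteq> 0" "lp_norm r M g \<noteq> 0" "lp_norm p M f = top \<or> lp_norm r M g = top"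
    | a b where "0 < a" "0 < b" "lp_norm p M f = ennreal a" "lp_norm r M g = ennreal b"
    by (cases "lp_norm p M f"; cases "lp_norm r M g")
       (auto simp: less_le)
  then show ?thesis
  proof cases
    case 1
    then have "AE x in M. f x * g x = 0"
      by (auto simp: lp_norm_eq_0_iff)
    then show ?thesis
      by (simp add: lp_norm_eq_0_iff[THEN iffD2])
  next
    case 2
    then show ?thesis
      by (auto simp: ennreal_mult_top ennreal_top_mult)
  next
    case (3 a b)
    \<comment> \<open>Young's inequality at \<open>f x / a\<close> and \<open>g x / b\<close>,
      rescaled; after integration the bracket becomes \<open>q / p + q / r = 1\<close>.\<close>
    have pt: "ennpowr (f x * g x) q \<le> ennreal ((a * b) powr q) *
        (ennreal (q / p / a powr p) * ennpowr (f x) p + ennreal (q / r / b powr r) * ennpowr (g x) r)" for x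
    proof (cases "f x = top \<or> g x = top")
      case True
      then show ?thesis
        using 3 assms by (auto simp: ennreal_mult_top ennreal_top_mult)
    next
      case False
      then obtain u v where uv: "f x = ennreal u" "g x = ennreal v" "0 \<le> u" "0 \<le> v"
        by (cases "f x"; cases "g x") auto
      have "(u * v) powr q = (a * b) powr q * (u / a * (v / b)) powr q"
        using 3 uv by (simp flip: powr_mult)
      also have "\<dots> \<le> (a * b) powr q * (q / p * (u / a) powr p + q / r * (v / b) powr r)"
        using 3 uv assms by (intro mult_left_mono Youngs_inequality_powr) auto
      also have "\<dots> = (a * b) powr q * (q / p / a powr p * u powr p + q / r / b powr r * v powr r)"
        using 3 uv by (simp add: powr_divide)
      finally show ?thesis
        using 3 uv assms by (simp add: ennpowr_ennreal flip: ennreal_mult ennreal_plus)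
    qed
    have ia: "(\<integral>\<^sup>+x. ennpowr (f x) p \<partial>M) = ennreal (a powr p)"
      using 3 lp_norm_powr[of p M f] assms by (simp add: ennpowr_ennreal)
    have ib: "(\<integral>\<^sup>+x. ennpowr (g x) r \<partial>M) = ennreal (b powr r)"
      using 3 lp_norm_powr[of r M g] assms by (simp add: ennpowr_ennreal)
    have pq: "q / p + q / r = 1"
      using assms(3,4) by (simp add: field_simps)
    have "(\<integral>\<^sup>+x. ennpowr (f x * g x) q \<partial>M) \<le> (\<integral>\<^sup>+x. ennreal ((a * b) powr q) *
        (ennreal (q / p / a powr p) * ennpowr (f x) p + ennreal (q / r / b powr r) * ennpowr (g x) r) \<partial>M)"
      by (intro nn_integral_mono pt)
    also have "\<dots> = ennreal ((a * b) powr q) * (ennreal (q / p / a powr p) * ennreal (a powr p)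
        + ennreal (q / r / b powr r) * ennreal (b powr r))"
      by (simp add: nn_integral_cmult nn_integral_add ia ib)
    also have "\<dots> = ennpowr (ennreal (a * b)) q"
      using 3 assms pq by (simp add: ennpowr_ennreal flip: ennreal_mult ennreal_plus)
    finally show ?thesis
      unfolding 3(3,4) unfolding lp_norm_def using 3(1,2) \<open>0 < q\<close>
      by (simp add: ennpowr_le_iff ennreal_mult)
  qed
qed

text \<open>Up to the factor \<open>a + b\<close>, the sum is a convex combination of the normalised
  functions \<open>f / a\<close> and \<open>g / b\<close> with weights \<open>a / (a + b)\<close>
  and \<open>b / (a + b)\<close>; convexity of the power then bounds its integral.\<close>

lemma lp_norm_Minkowski:
  assumes "1 \<le> p" and [measurable]: "f \<in> borel_measurable M" "g \<in> borel_measurable M"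
  shows "lp_norm p M (\<lambda>x. f x + g x) \<le> lp_norm p M f + lp_norm p M g"
proof -
  consider "lp_norm p M f = 0" | "lp_norm p M g = 0"
    | "lp_norm p M f = top \<or> lp_norm p M g = top"
    | a b where "0 < a" "0 < b" "lp_norm p M f = ennreal a" "lp_norm p M g = ennreal b"
    by (cases "lp_norm p M f"; cases "lp_norm p M g")
       (auto simp: less_le)
  then show ?thesis
  proof cases
    case 1
    then have "AE x in M. f x + g x = g x"
      by (auto simp: lp_norm_eq_0_iff)
    from lp_norm_cong_AE[OF this] show ?thesis
      by simp
  next
    case 2
    then have "AE x in M. f x + g x = f x"
      by (auto simp: lp_norm_eq_0_iff)
    from lp_norm_cong_AE[OF this] show ?thesis
      by simp
  next
    case 3
    then show ?thesis
      by auto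
  next
    case (4 a b)
    let ?A = "a / (a + b) / a powr p" and ?B = "b / (a + b) / b powr p"
    have pt: "ennpowr (f x + g x) p \<le> ennreal ((a + b) powr p) *
        (ennreal ?A * ennpowr (f x) p + ennreal ?B * ennpowr (g x) p)" for x
    proof (cases "f x = top \<or> g x = top")
      case True
      then show ?thesis
        using 4 assms by (auto simp: ennreal_mult_top ennreal_top_mult)
    next
      case False
      then obtain u v where uv: "f x = ennreal u" "g x = ennreal v" "0 \<le> u" "0 \<le> v"
        by (cases "f x"; cases "g x") auto
      have "u + v = (a + b) * (a / (a + b) * (u / a) + b / (a + b) * (v / b))"
        using 4 by (simp flip: add_divide_distrib)
      then have "(u + v) powr p = (a + b) powr p * (a / (a + b) * (u / a) + b / (a + b) * (v / b)) powr p"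
        using 4 uv by (metis powr_mult)
      also have "\<dots> \<le> (a + b) powr p * (a / (a + b) * (u / a) powr p + b / (a + b) * (v / b) powr p)"
        using 4 uv assms
        by (intro mult_left_mono powr_convex_nonneg) (auto simp flip: add_divide_distrib)
      also have "\<dots> = (a + b) powr p * (?A * u powr p + ?B * v powr p)"
        using 4 uv by (simp add: powr_divide)
      finally show ?thesis
        using 4 uv assms by (simp add: ennpowr_ennreal flip: ennreal_mult ennreal_plus)
    qed
    have ia: "(\<integral>\<^sup>+x. ennpowr (f x) p \<partial>M) = ennreal (a powr p)"
      using 4 lp_norm_powr[of p M f] assms by (simp add: ennpowr_ennreal)
    have ib: "(\<integral>\<^sup>+x. ennpowr (g x) p \<partial>M) = ennreal (b powr p)"
      using 4 lp_norm_powr[of p M g] assms by (simp add: ennpowr_ennreal)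
    have "(\<integral>\<^sup>+x. ennpowr (f x + g x) p \<partial>M) \<le> (\<integral>\<^sup>+x. ennreal ((a + b) powr p) *
        (ennreal ?A * ennpowr (f x) p + ennreal ?B * ennpowr (g x) p) \<partial>M)"
      by (intro nn_integral_mono pt)
    also have "\<dots> = ennreal ((a + b) powr p) * (ennreal ?A * ennreal (a powr p)
        + ennreal ?B * ennreal (b powr p))"
      by (simp add: nn_integral_cmult nn_integral_add ia ib)
    also have "\<dots> = ennpowr (ennreal (a + b)) p"
      using 4 assms by (simp add: ennpowr_ennreal flip: ennreal_mult ennreal_plus add_divide_distrib)
    finally show ?thesis
      unfolding 4(3,4) unfolding lp_norm_def using 4(1,2) \<open>1 \<le> p\<close>
      by (simp add: ennpowr_le_iff)
  qed
qed

text \<open>Minkowski bounds the partial sums, and monotone convergence passes to the limit.\<close>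

lemma lp_norm_suminf_le:
  assumes "1 \<le> p" and [measurable]: "\<And>n. F n \<in> borel_measurable M"
  shows "lp_norm p M (\<lambda>x. \<Sum>n. F n x) \<le> (\<Sum>n. lp_norm p M (F n))"
proof -
  have fin: "lp_norm p M (\<lambda>x. \<Sum>i<n. F i x) \<le> (\<Sum>i<n. lp_norm p M (F i))" for n
  proof (induction n)
    case 0
    then show ?case
      by (simp add: lp_norm_def)
  next
    case (Suc n)
    have "lp_norm p M (\<lambda>x. \<Sum>i<Suc n. F i x) \<le> lp_norm p M (\<lambda>x. \<Sum>i<n. F i x) + lp_norm p M (F n)"
      using lp_norm_Minkowski[OF assms(1), of "\<lambda>x. \<Sum>i<n. F i x" M "F n"] by simp
    also have "\<dots> \<le> (\<Sum>i<Suc n. lp_norm p M (F i))"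
      using Suc by (simp add: add_right_mono)
    finally show ?case .
  qed
  have "lp_norm p M (\<lambda>x. SUP n. \<Sum>i<n. F i x) = (SUP n. lp_norm p M (\<lambda>x. \<Sum>i<n. F i x))"
    using assms by (intro lp_norm_SUP) (auto simp: incseq_def le_fun_def intro!: sum_mono2)
  also have "\<dots> \<le> (SUP n. \<Sum>i<n. lp_norm p M (F i))"
    by (intro SUP_mono) (use fin in auto)
  finally show ?thesis
    by (simp add: suminf_eq_SUP)
qed

section \<open>Replacing one coordinate: measurability and null sets\<close>

lemma vec_upd_nth [simp]: "vec_upd x i t $ j = (if j = i then t else x $ j)"
  by (simp add: vec_upd_def)

lemma vec_upd_eq_plus: "vec_upd x i t = (t - x $ i) *\<^sub>R axis i 1 + x"
  by (simp add: vec_eq_iff axis_def)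

lemma borel_measurable_vec_upd [measurable (raw)]:
  fixes f :: "'a \<Rightarrow> real ^ 'n::finite"
  assumes [measurable]: "f \<in> borel_measurable M" "g \<in> borel_measurable M"
  shows "(\<lambda>x. vec_upd (f x) i (g x)) \<in> borel_measurable M"
proof -
  have "(\<lambda>x. x $ i) \<in> borel_measurable (borel :: (real ^ 'n) measure)"
    by (intro borel_measurable_continuous_onI continuous_intros)
  from measurable_compose[OF assms(1) this] show ?thesis
    unfolding vec_upd_eq_plus
    by (intro borel_measurable_add borel_measurable_scaleR borel_measurable_diff) auto
qed

lemma AE_lborel_plus:
  fixes c :: "'a::euclidean_space"
  assumes "AE x in lborel. P x"
  shows "AE x in lborel. P (c + x)"
  using assms by (subst (asm) lborel_distr_plus[symmetric, of c]) (rule AE_distrD, auto)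

text \<open>
  Translating by \<open>t e\<^sub>i\<close> preserves null sets for every \<open>t\<close>; exchanging the order of the
  two variables and translating \<open>t\<close> by \<open>x\<^sub>i\<close> gives the claim without decomposing the measure.
\<close>

lemma AE_lborel_vec_upd:
  fixes P :: "real ^ 'n::finite \<Rightarrow> bool"
  assumes "AE x in lborel. P x"
  shows "AE x in lborel. AE t in lborel. P (vec_upd x i t)"
proof -
  obtain N where N: "N \<in> null_sets lborel" "{x. \<not> P x} \<subseteq> N"
    using assms by (auto simp: eventually_ae_filter)
  have [measurable]: "N \<in> sets borel"
    using N by auto
  have "AE t in (lborel :: real measure). AE x in lborel. t *\<^sub>R axis i 1 + x \<notin> N"
    by (intro AE_I2 AE_lborel_plus[OF AE_not_in[OF N(1)]])
  then have "AE x in lborel. AE t in (lborel :: real measure). t *\<^sub>R axis i 1 + x \<notin> N"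
  proof (subst lborel_pair.AE_commute)
    have "Measurable.pred (lborel \<Otimes>\<^sub>M lborel)
        (\<lambda>x :: (real ^ 'n) \<times> real. snd x *\<^sub>R axis i 1 + fst x \<notin> N)"
      by measurable
    then show "{x \<in> space (lborel \<Otimes>\<^sub>M lborel).
        snd x *\<^sub>R axis i 1 + fst x \<notin> N} \<in> sets (lborel \<Otimes>\<^sub>M (lborel :: real measure))"
      by (simp add: pred_def)
  qed
  then show ?thesis
  proof eventually_elim
    case (elim x)
    from AE_lborel_plus[OF this, of "- x $ i"] show ?case
      by eventually_elim (use N in \<open>auto simp: vec_upd_eq_plus\<close>)
  qed
qed

section \<open>Iterated one-variable norms\<close>

text \<open>Unlike in \<open>iterated_int\<close>, the root is taken immediately after each
  integral, so each step is a genuine one-variable norm and inherits its inequalities.\<close>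

fun lp_iter ::
  "real ^ 'n \<Rightarrow> 'n list \<Rightarrow> (real ^ 'n \<Rightarrow> ennreal) \<Rightarrow> real ^ 'n \<Rightarrow> ennreal" where
  "lp_iter p [] G = G"
| "lp_iter p (i # is) G = lp_iter p is (\<lambda>x. lp_norm (p $ i) lborel (\<lambda>t. G (vec_upd x i t)))"

text \<open>The exponent \<open>p $ i / a\<close> splits into the root \<open>1 / a\<close> that
  closes the previous norm and the power \<open>p $ i\<close> that opens the next; generalising over
  \<open>a\<close> carries the pending root through the induction.\<close>

lemma iterated_int_eq_lp_iter:
  fixes p :: "real ^ 'n::finite"
  assumes "\<And>i. 0 < p $ i" "0 < a"
  shows "iterated_int p a is G = lp_iter p is (\<lambda>x. ennpowr (G x) (1 / a))"
  using assms(2)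
proof (induction "is" arbitrary: a G)
  case (Cons i "is")
  have "iterated_int p a (i # is) G = lp_iter p is
      (\<lambda>x. ennpowr (\<integral>\<^sup>+ t. ennpowr (G (vec_upd x i t)) (p $ i / a) \<partial>lebesgue) (1 / p $ i))"
    using Cons.IH[OF assms(1)] by simp
  then show ?case
    by (simp add: lp_norm_def nn_integral_completion ennpowr_ennpowr)
qed simp

text \<open>An exceptional null set has null sections along coordinate \<open>i\<close> through
  almost every point, so each integration preserves the hypothesis. No measurability is assumed,
  which allows arbitrary Lebesgue measurable functions to be compared with Borel ones.\<close>

lemma lp_iter_mono_AE:
  fixes p :: "real ^ 'n::finite"
  assumes "\<And>i. 0 < p $ i" "AE x in lborel. F x \<le> G x"
  shows "AE x in lborel. lp_iter p is F x \<le> lp_iter p is G x"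
  using assms(2)
proof (induction "is" arbitrary: F G)
  case (Cons i "is")
  have "AE x in lborel. lp_norm (p $ i) lborel (\<lambda>t. F (vec_upd x i t))
      \<le> lp_norm (p $ i) lborel (\<lambda>t. G (vec_upd x i t))"
    using AE_lborel_vec_upd[OF Cons.prems, of i]
    by eventually_elim (intro lp_norm_mono_AE assms)
  from Cons.IH[OF this] show ?case
    by simp
qed simp

lemma lp_iter_mono:
  fixes p :: "real ^ 'n::finite"
  assumes "\<And>i. 0 < p $ i" "\<And>x. F x \<le> G x"
  shows "lp_iter p is F x \<le> lp_iter p is G x"
  using assms(2)
proof (induction "is" arbitrary: F G)
  case (Cons i "is")
  then show ?case
    using assms(1) by (auto intro!: Cons.IH lp_norm_mono)
qed simp

lemma borel_measurable_lp_norm_vec_upd [measurable]: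
  fixes G :: "real ^ 'n::finite \<Rightarrow> ennreal"
  assumes [measurable]: "G \<in> borel_measurable borel"
  shows "(\<lambda>x. lp_norm p lborel (\<lambda>t. G (vec_upd x i t))) \<in> borel_measurable borel"
  unfolding lp_norm_def by measurable

lemma lp_iter_cmult:
  fixes p :: "real ^ 'n::finite"
  assumes "\<And>i. 0 < p $ i" "G \<in> borel_measurable borel"
  shows "lp_iter p is (\<lambda>x. c * G x) x = c * lp_iter p is G x"
  using assms(2)
proof (induction "is" arbitrary: G)
  case (Cons i "is")
  note [measurable] = Cons.prems
  have "(\<lambda>x. lp_norm (p $ i) lborel (\<lambda>t. c * G (vec_upd x i t)))
      = (\<lambda>x. c * lp_norm (p $ i) lborel (\<lambda>t. G (vec_upd x i t)))"
    using assms(1)[of i] by (intro ext lp_norm_cmult) auto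
  then show ?case
    by (simp add: Cons.IH)
qed simp

text \<open>One-variable Holder in the innermost coordinate leaves a product of two inner norms,
  which are Borel functions again, so the induction hypothesis applies to them.\<close>

lemma lp_iter_Holder:
  fixes p r q :: "real ^ 'n::finite"
  assumes "\<And>i. 0 < p $ i" "\<And>i. 0 < r $ i" "\<And>i. 0 < q $ i"
    and "\<And>i. 1 / q $ i = 1 / p $ i + 1 / r $ i"
    and "F \<in> borel_measurable borel" "G \<in> borel_measurable borel"
  shows "lp_iter q is (\<lambda>x. F x * G x) x \<le> lp_iter p is F x * lp_iter r is G x"
  using assms(5,6)
proof (induction "is" arbitrary: F G)
  case (Cons i "is")
  note [measurable] = Cons.prems
  have "lp_iter q (i # is) (\<lambda>x. F x * G x) x
      \<le> lp_iter q is (\<lambda>x. lp_norm (p $ i) lborel (\<lambda>t. F (vec_upd x i t))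
          * lp_norm (r $ i) lborel (\<lambda>t. G (vec_upd x i t))) x"
    by (simp, intro lp_iter_mono lp_norm_Holder assms) auto
  also have "\<dots> \<le> lp_iter p (i # is) F x * lp_iter r (i # is) G x"
    by (simp, intro Cons.IH) auto
  finally show ?case .
qed simp

lemma lp_iter_suminf_le:
  fixes p :: "real ^ 'n::finite"
  assumes "\<And>i. 1 \<le> p $ i" "\<And>n. F n \<in> borel_measurable borel"
  shows "lp_iter p is (\<lambda>x. \<Sum>n. F n x) x \<le> (\<Sum>n. lp_iter p is (F n) x)"
  using assms(2)
proof (induction "is" arbitrary: F)
  case (Cons i "is")
  note [measurable] = Cons.prems
  have pos: "0 < p $ i" for i
    using assms(1)[of i] by simp
  have "lp_iter p (i # is) (\<lambda>x. \<Sum>n. F n x) x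
      \<le> lp_iter p is (\<lambda>x. \<Sum>n. lp_norm (p $ i) lborel (\<lambda>t. F n (vec_upd x i t))) x"
    by (simp, intro lp_iter_mono lp_norm_suminf_le assms pos) auto
  also have "\<dots> \<le> (\<Sum>n. lp_iter p (i # is) (F n) x)"
    by (simp, intro Cons.IH) auto
  finally show ?case .
qed simp

text \<open>Each integration removes its coordinate from the set \<open>J\<close> on which the
  function depends. Once all coordinates are integrated, the result is constant.\<close>

lemma lp_iter_cong_coords:
  fixes p :: "real ^ 'n::finite"
  assumes "\<And>x y. (\<And>j. j \<in> J \<Longrightarrow> x $ j = y $ j) \<Longrightarrow> G x = G y"
    and "\<And>j. j \<in> J \<Longrightarrow> j \<notin> set is \<Longrightarrow> x $ j = y $ j"
  shows "lp_iter p is G x = lp_iter p is G y"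
  using assms
proof (induction "is" arbitrary: G J)
  case (Cons i "is")
  have "lp_norm (p $ i) lborel (\<lambda>t. G (vec_upd x i t)) = lp_norm (p $ i) lborel (\<lambda>t. G (vec_upd y i t))"
    if "\<And>j. j \<in> J - {i} \<Longrightarrow> x $ j = y $ j" for x y
    by (intro arg_cong2[where f="lp_norm (p $ i)"] refl ext Cons.prems(1))
       (use that in auto)
  then show ?case
    unfolding lp_iter.simps by (rule Cons.IH[where J="J - {i}"]) (use Cons.prems(2) in auto)
next
  case Nil
  from Nil.prems(1)[of x y] Nil.prems(2) show ?case
    by simp
qed

text \<open>Lebesgue measure is determined by its values on boxes, and the preimage of a box is a
  product of intervals.\<close>

lemma lborel_vec_eq_distr_PiM:
  "(lborel :: (real ^ 'n::finite) measure) = distr (\<Pi>\<^sub>M i\<in>UNIV. lborel) borel (\<lambda>f. \<chi> i. f i)"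
proof (rule lborel_eqI)
  interpret product_sigma_finite "\<lambda>_::'n. lborel :: real measure" ..
  have [measurable]: "(\<lambda>f. \<chi> i. f i) \<in> borel_measurable (\<Pi>\<^sub>M i\<in>(UNIV::'n set). (lborel :: real measure))"
    by (subst borel_measurable_euclidean_space) (auto simp: Basis_vec_def inner_axis)
  fix l u :: "real ^ 'n"
  assume lu: "\<And>b. b \<in> Basis \<Longrightarrow> l \<bullet> b \<le> u \<bullet> b"
  have le: "l $ i \<le> u $ i" for i
    using lu[of "axis i 1"] by (auto simp: Basis_vec_def inner_axis)
  have "(\<lambda>f. \<chi> i. f i) -` box l u \<inter> space (\<Pi>\<^sub>M i\<in>(UNIV::'n set). (lborel :: real measure))
      = (\<Pi>\<^sub>E i\<in>UNIV. {l $ i<..<u $ i})"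
    by (auto simp: box_def Basis_vec_def inner_axis space_PiM PiE_def Pi_def)
  then have "emeasure (distr (\<Pi>\<^sub>M i\<in>(UNIV::'n set). (lborel :: real measure)) borel (\<lambda>f. \<chi> i. f i)) (box l u)
      = (\<Prod>i\<in>UNIV. ennreal (u $ i - l $ i))"
    by (simp add: emeasure_distr emeasure_PiM le)
  also have "\<dots> = ennreal (\<Prod>i\<in>UNIV. (u - l) $ i)"
    using le by (simp add: prod_ennreal)
  also have "(\<Prod>i\<in>UNIV. (u - l) $ i) = (\<Prod>b\<in>Basis. (u - l) \<bullet> b)"
  proof -
    have "bij_betw (\<lambda>i. axis i (1::real)) (UNIV :: 'n set) Basis"
      by (auto simp: bij_betw_def inj_on_def axis_eq_axis Basis_vec_def)
    from prod.reindex_bij_betw[OF this, of "\<lambda>b. (u - l) \<bullet> b"]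
    show ?thesis
      by (simp add: inner_axis)
  qed
  finally show "emeasure (distr (\<Pi>\<^sub>M i\<in>(UNIV::'n set). (lborel :: real measure)) borel (\<lambda>f. \<chi> i. f i)) (box l u)
      = (\<Prod>b\<in>Basis. (u - l) \<bullet> b)" .
qed simp

text \<open>Tonelli's theorem, one coordinate at a time. Coordinates not yet in the list stay frozen
  at those of \<open>z\<close>, which makes the statement inductive.\<close>

lemma lp_iter_1_eq_nn_integral_PiM:
  fixes G :: "real ^ 'n::finite \<Rightarrow> ennreal"
  assumes "distinct is" "G \<in> borel_measurable borel"
  shows "lp_iter 1 is G z
    = (\<integral>\<^sup>+f. G (\<chi> j. if j \<in> set is then f j else z $ j) \<partial>(\<Pi>\<^sub>M i\<in>set is. lborel))"
  using assms
proof (induction "is" arbitrary: G)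
  case Nil
  then show ?case
    by (simp add: PiM_empty nn_integral_count_space_finite)
next
  case (Cons i "is")
  interpret product_sigma_finite "\<lambda>_::'n. lborel :: real measure" ..
  note [measurable] = Cons.prems(2)
  have meas[measurable]: "(\<lambda>f. \<chi> j. if j \<in> S then f j else z $ j)
      \<in> borel_measurable (\<Pi>\<^sub>M i\<in>S. (lborel :: real measure))" for S :: "'n set"
  proof -
    have "(\<lambda>f. if j \<in> S then f j else z $ j) \<in> borel_measurable (\<Pi>\<^sub>M i\<in>S. (lborel :: real measure))" for j
      by (cases "j \<in> S") simp_all
    then show ?thesis
      by (subst borel_measurable_euclidean_space) (auto simp: Basis_vec_def inner_axis)
  qed
  have "lp_iter 1 (i # is) G z = lp_iter 1 is (\<lambda>x. \<integral>\<^sup>+t. G (vec_upd x i t) \<partial>lborel) z"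
    by simp
  also have "\<dots> = (\<integral>\<^sup>+f. \<integral>\<^sup>+t. G (vec_upd (\<chi> j. if j \<in> set is then f j else z $ j) i t) \<partial>lborel
      \<partial>(\<Pi>\<^sub>M i\<in>set is. lborel))"
    using Cons.prems by (intro Cons.IH) auto
  also have "\<dots> = (\<integral>\<^sup>+f. \<integral>\<^sup>+t. G (\<chi> j. if j \<in> set (i # is) then (f(i := t)) j else z $ j) \<partial>lborel
      \<partial>(\<Pi>\<^sub>M i\<in>set is. lborel))"
    by (intro nn_integral_cong arg_cong[where f=G]) (auto simp: vec_eq_iff)
  also have "\<dots> = (\<integral>\<^sup>+f. G (\<chi> j. if j \<in> set (i # is) then f j else z $ j) \<partial>(\<Pi>\<^sub>M i\<in>set (i # is). lborel))"
    using Cons.prems unfolding list.set(2)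
    by (subst product_nn_integral_insert)
      (auto intro!: measurable_compose[OF meas[of "insert i (set is)", simplified]])
  finally show ?case .
qed

text \<open>Each integration pulls out one factor; the constant \<open>c\<close> collects those
  already integrated.\<close>

lemma lp_iter_prod:
  fixes p :: "real ^ 'n::finite"
  assumes "\<And>i. 0 < p $ i" "distinct is" "h \<in> borel_measurable borel"
  shows "lp_iter p is (\<lambda>x. c * (\<Prod>j\<in>set is. h (x $ j))) x = c * (\<Prod>j\<in>set is. lp_norm (p $ j) lborel h)"
  using assms(2)
proof (induction "is" arbitrary: c)
  case (Cons i "is")
  note [measurable] = assms(3)
  have "lp_norm (p $ i) lborel (\<lambda>t. c * (\<Prod>j\<in>set (i # is). h (vec_upd x i t $ j)))
      = c * lp_norm (p $ i) lborel h * (\<Prod>j\<in>set is. h (x $ j))" for x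
  proof -
    have "(\<Prod>j\<in>set is. h (vec_upd x i t $ j)) = (\<Prod>j\<in>set is. h (x $ j))" for t
      using Cons.prems by (intro prod.cong) auto
    then have "lp_norm (p $ i) lborel (\<lambda>t. c * (\<Prod>j\<in>set (i # is). h (vec_upd x i t $ j)))
        = lp_norm (p $ i) lborel (\<lambda>t. c * (\<Prod>j\<in>set is. h (x $ j)) * h t)"
      using Cons.prems by (simp add: mult_ac)
    also have "\<dots> = c * (\<Prod>j\<in>set is. h (x $ j)) * lp_norm (p $ i) lborel h"
      using assms(1)[of i] by (intro lp_norm_cmult) auto
    finally show ?thesis
      by (simp add: mult_ac)
  qed
  then have "lp_iter p (i # is) (\<lambda>x. c * (\<Prod>j\<in>set (i # is). h (x $ j))) x
      = c * lp_norm (p $ i) lborel h * (\<Prod>j\<in>set is. lp_norm (p $ j) lborel h)"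
    using Cons.prems by (simp only: lp_iter.simps Cons.IH distinct.simps)
  then show ?case
    using Cons.prems by (simp add: mult_ac)
qed simp

section \<open>Mixed norms of Lebesgue measurable functions\<close>

definition mixed_lp ::
  "real ^ 'n::{finite,linorder} \<Rightarrow> (real ^ 'n::{finite,linorder} \<Rightarrow> ennreal) \<Rightarrow> ennreal" where
  "mixed_lp p G = lp_iter p (sorted_list_of_set UNIV) G 0"

lemma mixed_norm_eq_mixed_lp:
  "(\<And>i. 0 < p $ i) \<Longrightarrow> mixed_norm p f = mixed_lp p (\<lambda>x. ennreal (cmod (f x)))"
  by (simp add: mixed_norm_def mixed_lp_def iterated_int_eq_lp_iter)

text \<open>Both iterated norms are constant in the base point, so an almost everywhere inequality
  between them holds everywhere or nowhere; the latter is impossible because the whole space is not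
  a null set.\<close>

lemma mixed_lp_mono_AE:
  assumes "\<And>i. 0 < p $ i" "AE x in lebesgue. F x \<le> G x"
  shows "mixed_lp p F \<le> mixed_lp p G"
proof -
  have const: "lp_iter p (sorted_list_of_set UNIV) F x = mixed_lp p F" for F x
    unfolding mixed_lp_def
  proof (rule lp_iter_cong_coords[where J=UNIV])
    fix x y :: "(real, 'a) vec"
    assume "\<And>j. j \<in> UNIV \<Longrightarrow> x $ j = y $ j"
    then have "x = y"
      by (simp add: vec_eq_iff)
    then show "F x = F y"
      by simp
  qed simp
  have "AE x in lborel. F x \<le> G x"
    using assms(2) by (simp add: AE_completion_iff)
  from lp_iter_mono_AE[OF assms(1) this, of "sorted_list_of_set UNIV"]
  have "AE x in (lborel :: ((real, 'a) vec) measure). mixed_lp p F \<le> mixed_lp p G"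
    by (simp add: const)
  then obtain N where N: "{x :: (real, 'a) vec. \<not> mixed_lp p F \<le> mixed_lp p G} \<subseteq> N" "emeasure lborel N = 0"
    by (auto elim: AE_E)
  show ?thesis
  proof (rule ccontr)
    assume "\<not> ?thesis"
    with N(1) have "N = UNIV"
      by auto
    with N(2) show False
      by simp
  qed
qed

lemma mixed_lp_mono:
  "(\<And>i. 0 < p $ i) \<Longrightarrow> (\<And>x. F x \<le> G x) \<Longrightarrow> mixed_lp p F \<le> mixed_lp p G"
  by (rule mixed_lp_mono_AE) auto

lemma mixed_lp_cong_AE:
  assumes "\<And>i. 0 < p $ i" "AE x in lebesgue. F x = G x"
  shows "mixed_lp p F = mixed_lp p G"
proof (rule antisym)
  show "mixed_lp p F \<le> mixed_lp p G"
    using assms(2) by (intro mixed_lp_mono_AE assms(1)) (auto elim: eventually_mono)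
  show "mixed_lp p G \<le> mixed_lp p F"
    using assms(2) by (intro mixed_lp_mono_AE assms(1)) (auto elim: eventually_mono)
qed

lemma lebesgue_ennreal_borel_AE:
  fixes G :: "'a::euclidean_space \<Rightarrow> ennreal"
  assumes "G \<in> borel_measurable lebesgue"
  obtains G' where "G' \<in> borel_measurable borel" "AE x in lebesgue. G x = G' x"
  using completion_ex_borel_measurable[OF assms] by (auto simp: AE_completion_iff)

lemma mixed_lp_cmult:
  assumes "\<And>i. 0 < p $ i" "G \<in> borel_measurable lebesgue"
  shows "mixed_lp p (\<lambda>x. c * G x) = c * mixed_lp p G"
proof -
  obtain G' where G': "G' \<in> borel_measurable borel" "AE x in lebesgue. G x = G' x"
    using lebesgue_ennreal_borel_AE[OF assms(2)] .
  have "mixed_lp p (\<lambda>x. c * G x) = mixed_lp p (\<lambda>x. c * G' x)"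
    using G'(2) by (intro mixed_lp_cong_AE assms(1)) (auto elim: eventually_mono)
  also have "\<dots> = c * mixed_lp p G'"
    unfolding mixed_lp_def by (intro lp_iter_cmult assms(1) G')
  also have "mixed_lp p G' = mixed_lp p G"
    by (rule mixed_lp_cong_AE[symmetric]) (use assms(1) G' in auto)
  finally show ?thesis .
qed

lemma mixed_lp_Holder:
  assumes "\<And>i. 0 < p $ i" "\<And>i. 0 < r $ i" "\<And>i. 0 < q $ i"
    and "\<And>i. 1 / q $ i = 1 / p $ i + 1 / r $ i"
    and "F \<in> borel_measurable lebesgue" "G \<in> borel_measurable lebesgue"
  shows "mixed_lp q (\<lambda>x. F x * G x) \<le> mixed_lp p F * mixed_lp r G"
proof -
  obtain F' where F': "F' \<in> borel_measurable borel" "AE x in lebesgue. F x = F' x"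
    using lebesgue_ennreal_borel_AE[OF assms(5)] .
  obtain G' where G': "G' \<in> borel_measurable borel" "AE x in lebesgue. G x = G' x"
    using lebesgue_ennreal_borel_AE[OF assms(6)] .
  have "AE x in lebesgue. F x * G x = F' x * G' x"
    using F'(2) G'(2) by eventually_elim simp
  then have "mixed_lp q (\<lambda>x. F x * G x) = mixed_lp q (\<lambda>x. F' x * G' x)"
    by (intro mixed_lp_cong_AE assms(3))
  also have "\<dots> \<le> mixed_lp p F' * mixed_lp r G'"
    unfolding mixed_lp_def by (intro lp_iter_Holder assms F' G')
  also have "mixed_lp p F' = mixed_lp p F"
    by (rule mixed_lp_cong_AE[symmetric]) (use assms(1) F' in auto)
  also have "mixed_lp r G' = mixed_lp r G"
    by (rule mixed_lp_cong_AE[symmetric]) (use assms(2) G' in auto)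
  finally show ?thesis .
qed

lemma mixed_lp_suminf_le:
  assumes "\<And>i. 1 \<le> p $ i" "\<And>n. F n \<in> borel_measurable lebesgue"
  shows "mixed_lp p (\<lambda>x. \<Sum>n. F n x) \<le> (\<Sum>n. mixed_lp p (F n))"
proof -
  have pos: "0 < p $ i" for i
    using assms(1)[of i] by simp
  have "\<exists>G. G \<in> borel_measurable borel \<and> (AE x in lebesgue. F n x = G x)" for n
    using lebesgue_ennreal_borel_AE[OF assms(2)[of n]] by blast
  then obtain G where G: "\<And>n. G n \<in> borel_measurable borel" "\<And>n. AE x in lebesgue. F n x = G n x"
    by metis
  have "AE x in lebesgue. \<forall>n. F n x = G n x"
    using G(2) by (simp add: AE_all_countable)
  then have "mixed_lp p (\<lambda>x. \<Sum>n. F n x) = mixed_lp p (\<lambda>x. \<Sum>n. G n x)"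
    by (intro mixed_lp_cong_AE pos) (auto elim: eventually_mono)
  also have "\<dots> \<le> (\<Sum>n. mixed_lp p (G n))"
    unfolding mixed_lp_def by (intro lp_iter_suminf_le assms(1) G)
  also have "(\<lambda>n. mixed_lp p (G n)) = (\<lambda>n. mixed_lp p (F n))"
    by (intro ext mixed_lp_cong_AE[symmetric] pos G)
  finally show ?thesis .
qed

text \<open>The case of a series whose terms vanish from index 2 on.\<close>

lemma mixed_lp_add_le:
  assumes "\<And>i. 1 \<le> p $ i" "F \<in> borel_measurable lebesgue" "G \<in> borel_measurable lebesgue"
  shows "mixed_lp p (\<lambda>x. F x + G x) \<le> mixed_lp p F + mixed_lp p G"
proof -
  have pos: "0 < p $ i" for i
    using assms(1)[of i] by simp
  define H where "H n = (if n = 0 then F else if n = 1 then G else (\<lambda>_. 0))" for n :: nat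
  have "mixed_lp p (\<lambda>_. 0) = 0"
    using mixed_lp_cmult[OF pos, of "\<lambda>_. 0" 0] by simp
  then have "(\<Sum>n. mixed_lp p (H n)) = mixed_lp p F + mixed_lp p G"
    by (subst suminf_finite[where N="{0, 1}"]) (auto simp: H_def)
  moreover have "(\<lambda>x. \<Sum>n. H n x) = (\<lambda>x. F x + G x)"
    by (intro ext, subst suminf_finite[where N="{0, 1}"]) (auto simp: H_def)
  moreover have "mixed_lp p (\<lambda>x. \<Sum>n. H n x) \<le> (\<Sum>n. mixed_lp p (H n))"
    by (rule mixed_lp_suminf_le) (use assms in \<open>auto simp: H_def\<close>)
  ultimately show ?thesis
    by simp
qed

lemma mixed_lp_1:
  assumes "G \<in> borel_measurable lebesgue"
  shows "mixed_lp 1 G = (\<integral>\<^sup>+x. G x \<partial>lebesgue)"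
proof -
  obtain G' where G': "G' \<in> borel_measurable borel" "AE x in lebesgue. G x = G' x"
    using lebesgue_ennreal_borel_AE[OF assms] .
  note [measurable] = G'(1)
  have [measurable]: "(\<lambda>f. \<chi> i. f i) \<in> borel_measurable (\<Pi>\<^sub>M i\<in>(UNIV::'a set). (lborel :: real measure))"
    by (subst borel_measurable_euclidean_space) (auto simp: Basis_vec_def inner_axis)
  have "mixed_lp 1 G = mixed_lp 1 G'"
    using G'(2) by (intro mixed_lp_cong_AE) auto
  also have "\<dots> = (\<integral>\<^sup>+f. G' (\<chi> i. f i) \<partial>(\<Pi>\<^sub>M i\<in>UNIV. lborel))"
    unfolding mixed_lp_def by (subst lp_iter_1_eq_nn_integral_PiM) auto
  also have "\<dots> = (\<integral>\<^sup>+x. G' x \<partial>lborel)"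
    by (subst lborel_vec_eq_distr_PiM) (simp add: nn_integral_distr)
  also have "\<dots> = (\<integral>\<^sup>+x. G' x \<partial>lebesgue)"
    by (simp add: nn_integral_completion)
  also have "\<dots> = (\<integral>\<^sup>+x. G x \<partial>lebesgue)"
    using G'(2) by (intro nn_integral_cong_AE) (auto elim: eventually_mono)
  finally show ?thesis .
qed

section \<open>Mixed norms on cubes and balls\<close>

text \<open>The indicator of a cube is a product of one-variable indicators; an interval of length
  \<open>2 * s\<close> contributes the factor \<open>(2 * s) powr (1 / p $ i)\<close>.\<close>

lemma mixed_lp_indicator_cube:
  fixes p :: "real ^ 'n::{finite,linorder}"
  assumes "\<And>i. 0 < p $ i" "0 < s"
  shows "mixed_lp p (indicator {x. \<forall>i. \<bar>x $ i\<bar> \<le> s}) = ennreal ((2 * s) powr (\<Sum>i\<in>UNIV. 1 / p $ i))"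
proof -
  have ind: "indicator {x. \<forall>i. \<bar>x $ i\<bar> \<le> s}
      = (\<lambda>x::(real, 'n) vec. 1 * (\<Prod>j\<in>set (sorted_list_of_set UNIV). indicator {-s..s} (x $ j) :: ennreal))"
  proof
    fix x :: "(real, 'n) vec"
    show "indicator {x. \<forall>i. \<bar>x $ i\<bar> \<le> s} x
      = 1 * (\<Prod>j\<in>set (sorted_list_of_set UNIV). indicator {-s..s} (x $ j) :: ennreal)"
    proof (cases "\<forall>i. \<bar>x $ i\<bar> \<le> s")
      case True
      then have "x $ i \<in> {-s..s}" for i
        by (auto simp: abs_le_iff minus_le_iff)
      then show ?thesis
        using True by simp
    next
      case False
      then obtain i where "\<not> \<bar>x $ i\<bar> \<le> s"
        by blast
      then have "x $ i \<notin> {-s..s}"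
        by auto
      then have "(\<Prod>j\<in>UNIV. indicator {-s..s} (x $ j)) = (0 :: ennreal)"
        by (intro prod_zero bexI[of _ i]) (auto simp: indicator_def)
      then show ?thesis
        using False by simp
    qed
  qed
  have "ennpowr (indicator {-s..s} x) a = indicator {-s..s} x" for x a :: real
    using ennpowr_ennreal[of 1 a] by (auto simp: indicator_def)
  then have "lp_norm a lborel (indicator {-s..s}) = ennreal ((2 * s) powr (1 / a))" for a
    using assms(2) by (simp add: lp_norm_def ennpowr_ennreal)
  then show ?thesis
    unfolding mixed_lp_def ind
    by (subst lp_iter_prod) (use assms in \<open>auto simp: prod_ennreal powr_sum\<close>)
qed

lemma mixed_lp_indicator_ball_le:
  fixes p :: "real ^ 'n::{finite,linorder}"
  assumes "\<And>i. 0 < p $ i" "0 < r"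
  shows "mixed_lp p (indicator (ball 0 r)) \<le> ennreal ((2 * r) powr (\<Sum>i\<in>UNIV. 1 / p $ i))"
proof -
  have "\<bar>x $ i\<bar> \<le> r" if "norm x < r" for x :: "(real, 'n) vec" and i
    using component_le_norm_cart[of x i] that by simp
  then have "mixed_lp p (indicator (ball 0 r)) \<le> mixed_lp p (indicator {x. \<forall>i. \<bar>x $ i\<bar> \<le> r})"
    by (intro mixed_lp_mono assms) (auto simp: indicator_def)
  then show ?thesis
    by (simp add: mixed_lp_indicator_cube assms)
qed

lemma mixed_lp_indicator_ball_ge:
  fixes p :: "real ^ 'n::{finite,linorder}"
  assumes "\<And>i. 0 < p $ i" "0 < r"
  shows "ennreal ((r / CARD('n)) powr (\<Sum>i\<in>UNIV. 1 / p $ i)) \<le> mixed_lp p (indicator (ball 0 r))"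
proof -
  \<comment> \<open>The cube of side \<open>r / CARD('n)\<close> has l1 norm at most
    \<open>r / 2\<close>, so it lies inside the open ball.\<close>
  let ?s = "r / (2 * CARD('n))"
  have "norm x < r" if "\<forall>i. \<bar>x $ i\<bar> \<le> ?s" for x :: "(real, 'n) vec"
  proof -
    have "norm x \<le> (\<Sum>i\<in>UNIV. \<bar>x $ i\<bar>)"
      by (rule norm_le_l1_cart)
    also have "\<dots> \<le> (\<Sum>i\<in>(UNIV :: 'n set). ?s)"
      by (intro sum_mono) (use that in blast)
    also have "\<dots> < r"
      using assms(2) by simp
    finally show ?thesis .
  qed
  then have "mixed_lp p (indicator {x. \<forall>i. \<bar>x $ i\<bar> \<le> ?s}) \<le> mixed_lp p (indicator (ball 0 r))"
    by (intro mixed_lp_mono assms) (auto simp: indicator_def)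
  then show ?thesis
    using assms by (simp add: mixed_lp_indicator_cube)
qed

lemma sets_lebesgue_ball [measurable, simp]: "ball c r \<in> sets lebesgue"
  by simp

lemma mixed_lp_times_indicator_ball_le:
  fixes p r q :: "real ^ 'n::{finite,linorder}"
  assumes "\<And>i. 0 < p $ i" "\<And>i. 0 < r $ i" "\<And>i. 0 < q $ i"
    and "\<And>i. 1 / q $ i = 1 / p $ i + 1 / r $ i"
    and [measurable]: "F \<in> borel_measurable lebesgue" and "0 < R"
  shows "mixed_lp q (\<lambda>x. F x * indicator (ball 0 R) x)
    \<le> mixed_lp p (\<lambda>x. F x * indicator (ball 0 R) x) * ennreal ((2 * R) powr (\<Sum>i\<in>UNIV. 1 / r $ i))"
proof -
  have "mixed_lp q (\<lambda>x. F x * indicator (ball 0 R) x)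
      = mixed_lp q (\<lambda>x. (F x * indicator (ball 0 R) x) * indicator (ball 0 R) x)"
    by (intro arg_cong[where f="mixed_lp q"]) (auto simp: indicator_def)
  also have "\<dots> \<le> mixed_lp p (\<lambda>x. F x * indicator (ball 0 R) x) * mixed_lp r (indicator (ball 0 R))"
    by (intro mixed_lp_Holder assms) measurable
  also have "\<dots> \<le> mixed_lp p (\<lambda>x. F x * indicator (ball 0 R) x)
      * ennreal ((2 * R) powr (\<Sum>i\<in>UNIV. 1 / r $ i))"
    by (intro mult_left_mono mixed_lp_indicator_ball_le assms) auto
  finally show ?thesis .
qed

text \<open>Holder against the indicator of the ball, with target exponent 1 and the conjugate
  exponents \<open>p'\<close>, whose reciprocals sum to n minus the sum of the
  \<open>1 / p $ i\<close>.\<close>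

lemma nn_integral_ball_le_mixed_lp:
  fixes p :: "real ^ 'n::{finite,linorder}"
  assumes "\<And>i. 1 < p $ i" and [measurable]: "F \<in> borel_measurable lebesgue" and "0 < R"
  shows "(\<integral>\<^sup>+x. F x * indicator (ball 0 R) x \<partial>lebesgue)
    \<le> mixed_lp p (\<lambda>x. F x * indicator (ball 0 R) x)
      * ennreal ((2 * R) powr (CARD('n) - (\<Sum>i\<in>UNIV. 1 / p $ i)))"
proof -
  define p' :: "(real, 'n) vec" where "p' = (\<chi> i. p $ i / (p $ i - 1))"
  have pos: "0 < p $ i" "p $ i \<noteq> 1" for i
    using assms(1)[of i] by auto
  have p': "1 / p' $ i = 1 - 1 / p $ i" for i
    using pos[of i] by (simp add: p'_def field_simps)
  then have "(\<Sum>i\<in>UNIV. 1 / p' $ i) = CARD('n) - (\<Sum>i\<in>UNIV. 1 / p $ i)"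
    by (simp add: sum_subtractf)
  moreover have "0 < p' $ i" for i
    using assms(1)[of i] by (simp add: p'_def)
  moreover have "1 / (1 :: (real, 'n) vec) $ i = 1 / p $ i + 1 / p' $ i" for i
    using p'[of i] by simp
  ultimately show ?thesis
    using mixed_lp_times_indicator_ball_le[of p p' 1 F R] pos assms(3)
    by (simp add: mixed_lp_1)
qed

section \<open>Measurability and pointwise bounds for the Hardy operator and its commutator\<close>

lemma lebesgue_complex_borel_AE:
  fixes f :: "'a::euclidean_space \<Rightarrow> complex"
  assumes [measurable]: "f \<in> borel_measurable lebesgue"
  obtains f' where "f' \<in> borel_measurable borel" "AE x in lebesgue. f x = f' x"
proof -
  have "(\<lambda>x. Re (f x)) \<in> borel_measurable lebesgue" "(\<lambda>x. Im (f x)) \<in> borel_measurable lebesgue"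
    by measurable
  then obtain u v :: "'a \<Rightarrow> real" where [measurable]: "u \<in> borel_measurable lborel" "v \<in> borel_measurable lborel"
    and ae: "AE x in lborel. Re (f x) = u x" "AE x in lborel. Im (f x) = v x"
    using completion_ex_borel_measurable_real[of "\<lambda>x. Re (f x)" lborel]
      completion_ex_borel_measurable_real[of "\<lambda>x. Im (f x)" lborel] by auto
  have "(\<lambda>x. complex_of_real (u x) + \<i> * complex_of_real (v x)) \<in> borel_measurable lborel"
    by measurable
  moreover have "AE x in lborel. f x = complex_of_real (u x) + \<i> * complex_of_real (v x)"
    using ae by eventually_elim (simp add: complex_eq_iff)
  ultimately show thesis
    by (intro that) (auto simp: AE_completion_iff)
qed

text \<open>The domain of integration varies with \<open>x\<close>. For a Borel representative
  \<open>f'\<close> the truncated integrand is jointly Borel in \<open>x\<close> and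
  \<open>t\<close>, so the parameter integral is measurable.\<close>

lemma borel_measurable_hardy:
  fixes f :: "real ^ 'n::finite \<Rightarrow> complex"
  assumes [measurable]: "f \<in> borel_measurable lebesgue"
  shows "hardy f \<in> borel_measurable lebesgue"
proof -
  obtain f' where [measurable]: "f' \<in> borel_measurable borel" and ae: "AE x in lebesgue. f x = f' x"
    using lebesgue_complex_borel_AE[OF assms] .
  have [measurable]: "f' \<in> borel_measurable lebesgue"
    by (simp add: measurable_completion)
  have "hardy f x = (\<integral>t. (if norm t < norm x then f' t else 0) \<partial>lborel) /\<^sub>R norm x ^ CARD('n)" for x
  proof -
    have "(LINT t:ball 0 (norm x)|lebesgue. f t) = (LINT t:ball 0 (norm x)|lebesgue. f' t)"
      unfolding set_lebesgue_integral_def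
      by (intro integral_cong_AE) (use ae in \<open>auto elim: eventually_mono\<close>)
    also have "\<dots> = (\<integral>t. indicator (ball 0 (norm x)) t *\<^sub>R f' t \<partial>lborel)"
    proof -
      have "(\<lambda>t. indicator (ball 0 (norm x)) t *\<^sub>R f' t) \<in> borel_measurable borel"
        by (intro borel_measurable_scaleR borel_measurable_indicator) auto
      then show ?thesis
        unfolding set_lebesgue_integral_def by (intro integral_completion) simp
    qed
    also have "\<dots> = (\<integral>t. (if norm t < norm x then f' t else 0) \<partial>lborel)"
      by (intro Bochner_Integration.integral_cong) auto
    finally show ?thesis
      by (simp add: hardy_def)
  qed
  then have "hardy f = (\<lambda>x. (\<integral>t. (if norm t < norm x then f' t else 0) \<partial>lborel) /\<^sub>R norm x ^ CARD('n))"
    by auto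
  moreover have "\<dots> \<in> borel_measurable borel"
    by measurable
  ultimately show ?thesis
    by (simp add: measurable_completion)
qed

lemma borel_measurable_hardy_comm:
  fixes f b :: "real ^ 'n::finite \<Rightarrow> complex"
  assumes [measurable]: "f \<in> borel_measurable lebesgue" "b \<in> borel_measurable lebesgue"
  shows "hardy_comm b f \<in> borel_measurable lebesgue"
proof -
  have [measurable]: "hardy f \<in> borel_measurable lebesgue"
      "hardy (\<lambda>t. f t * b t) \<in> borel_measurable lebesgue"
    by (intro borel_measurable_hardy; measurable)+
  show ?thesis
    unfolding hardy_comm_def by measurable
qed

text \<open>The commutator does not see constants added to \<open>b\<close>; this is what permits
  subtracting a mean.\<close>

lemma hardy_comm_eq:
  fixes f b :: "real ^ 'n::finite \<Rightarrow> complex"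
  assumes "set_integrable lebesgue (ball 0 (norm x)) f"
    and "set_integrable lebesgue (ball 0 (norm x)) (\<lambda>t. f t * b t)"
  shows "hardy_comm b f x = ((b x - c) * (LINT t:ball 0 (norm x)|lebesgue. f t)
    - (LINT t:ball 0 (norm x)|lebesgue. f t * (b t - c))) /\<^sub>R norm x ^ CARD('n)"
proof -
  have "(LINT t:ball 0 (norm x)|lebesgue. f t * (b t - c))
      = (LINT t:ball 0 (norm x)|lebesgue. f t * b t - f t * c)"
    by (simp add: algebra_simps)
  also have "\<dots> = (LINT t:ball 0 (norm x)|lebesgue. f t * b t) - (LINT t:ball 0 (norm x)|lebesgue. f t) * c"
    using assms by (subst set_integral_diff) auto
  finally show ?thesis
    by (simp add: hardy_comm_def hardy_def algebra_simps scaleR_right_diff_distrib)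
qed

lemma norm_set_integral_le_nn_integral:
  fixes g :: "'a::euclidean_space \<Rightarrow> complex"
  assumes "set_integrable lebesgue A g" "A \<subseteq> B"
  shows "ennreal (cmod (LINT t:A|lebesgue. g t)) \<le> (\<integral>\<^sup>+t. ennreal (cmod (g t)) * indicator B t \<partial>lebesgue)"
proof -
  have "ennreal (cmod (LINT t:A|lebesgue. g t)) \<le> (\<integral>\<^sup>+t. ennreal (cmod (indicator A t *\<^sub>R g t)) \<partial>lebesgue)"
    using assms(1) unfolding set_integrable_def set_lebesgue_integral_def
    by (rule integral_norm_bound_ennreal)
  also have "\<dots> \<le> (\<integral>\<^sup>+t. ennreal (cmod (g t)) * indicator B t \<partial>lebesgue)"
    using assms(2) by (intro nn_integral_mono) (auto simp: indicator_def)
  finally show ?thesis .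
qed

lemma set_integrable_iff_nn_integral_finite:
  fixes g :: "'a::euclidean_space \<Rightarrow> complex"
  assumes [measurable]: "g \<in> borel_measurable lebesgue" "A \<in> sets lebesgue"
  shows "set_integrable lebesgue A g \<longleftrightarrow> (\<integral>\<^sup>+t. ennreal (cmod (g t)) * indicator A t \<partial>lebesgue) < \<infinity>"
proof -
  have "(\<integral>\<^sup>+t. ennreal (cmod (indicator A t *\<^sub>R g t)) \<partial>lebesgue)
      = (\<integral>\<^sup>+t. ennreal (cmod (g t)) * indicator A t \<partial>lebesgue)"
    by (intro nn_integral_cong) (auto simp: indicator_def)
  then show ?thesis
    unfolding set_integrable_def integrable_iff_bounded by auto
qed

lemma cmod_hardy_comm_le:
  fixes f b :: "real ^ 'n::finite \<Rightarrow> complex"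
  assumes f: "set_integrable lebesgue (ball 0 R) f"
    and fb: "set_integrable lebesgue (ball 0 R) (\<lambda>t. f t * b t)"
    and R: "0 < R" "R / 2 \<le> norm x" "norm x < R"
  shows "ennreal (cmod (hardy_comm b f x)) \<le> ennreal ((2 / R) ^ CARD('n)) *
    (ennreal (cmod (b x - c)) * (\<integral>\<^sup>+t. ennreal (cmod (f t)) * indicator (ball 0 R) t \<partial>lebesgue)
      + (\<integral>\<^sup>+t. ennreal (cmod (f t * (b t - c))) * indicator (ball 0 R) t \<partial>lebesgue))"
proof -
  have sub: "ball 0 (norm x) \<subseteq> (ball 0 R :: (real, 'n) vec set)"
    using R by auto
  have f': "set_integrable lebesgue (ball 0 (norm x)) f"
    using f by (rule set_integrable_subset) (use sub in auto)
  have fb': "set_integrable lebesgue (ball 0 (norm x)) (\<lambda>t. f t * b t)"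
    using fb by (rule set_integrable_subset) (use sub in auto)
  have "set_integrable lebesgue (ball 0 (norm x)) (\<lambda>t. f t * b t - f t * c)"
    using f' fb' by (intro set_integral_diff) auto
  then have fc': "set_integrable lebesgue (ball 0 (norm x)) (\<lambda>t. f t * (b t - c))"
    by (simp add: algebra_simps)
  let ?I = "LINT t:ball 0 (norm x)|lebesgue. f t"
  let ?J = "LINT t:ball 0 (norm x)|lebesgue. f t * (b t - c)"
  \<comment> \<open>The inner radius of the shell controls the kernel, the outer one the domain of
    integration.\<close>
  have "inverse (norm x) \<le> 2 / R"
    using le_imp_inverse_le[OF R(2) half_gt_zero[OF R(1)]] by (simp only: inverse_divide)
  then have "inverse (norm x) ^ CARD('n) \<le> (2 / R) ^ CARD('n)"
    by (rule power_mono) simp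
  then have "inverse (norm x ^ CARD('n)) \<le> (2 / R) ^ CARD('n)"
    by (simp only: power_inverse)
  moreover have "cmod ((b x - c) * ?I - ?J) \<le> cmod (b x - c) * cmod ?I + cmod ?J"
    using norm_triangle_ineq4[of "(b x - c) * ?I" ?J] by (simp only: norm_mult)
  moreover have "cmod (hardy_comm b f x) = inverse (norm x ^ CARD('n)) * cmod ((b x - c) * ?I - ?J)"
    unfolding hardy_comm_eq[OF f' fb', of c] by simp
  ultimately have "cmod (hardy_comm b f x) \<le> (2 / R) ^ CARD('n) * (cmod (b x - c) * cmod ?I + cmod ?J)"
    using R by (simp only:) (intro mult_mono, auto)
  then have "ennreal (cmod (hardy_comm b f x))
      \<le> ennreal ((2 / R) ^ CARD('n) * (cmod (b x - c) * cmod ?I + cmod ?J))"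
    by (rule ennreal_leI)
  also have "\<dots> = ennreal ((2 / R) ^ CARD('n)) * (ennreal (cmod (b x - c)) * ennreal (cmod ?I) + ennreal (cmod ?J))"
    using R by (simp add: ennreal_mult)
  also have "\<dots> \<le> ennreal ((2 / R) ^ CARD('n)) *
    (ennreal (cmod (b x - c)) * (\<integral>\<^sup>+t. ennreal (cmod (f t)) * indicator (ball 0 R) t \<partial>lebesgue)
      + (\<integral>\<^sup>+t. ennreal (cmod (f t * (b t - c))) * indicator (ball 0 R) t \<partial>lebesgue))"
    by (intro mult_left_mono add_mono norm_set_integral_le_nn_integral f' fc' sub) auto
  finally show ?thesis .
qed

section \<open>The estimate on one shell\<close>

text \<open>Both terms of the pointwise bound contribute \<open>u * v * (2 * R) ^ CARD('n)\<close>,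
  which gives the factor 2; multiplied by \<open>(2 / R) ^ CARD('n)\<close> this leaves
  \<open>4 ^ CARD('n)\<close> and no power of \<open>R\<close>.\<close>

lemma
  fixes p1 p2 q :: "real ^ 'n::{finite,linorder}" and f b :: "real ^ 'n::{finite,linorder} \<Rightarrow> complex"
  assumes p1: "\<And>i. 1 < p1 $ i" and p2: "\<And>i. 0 < p2 $ i" and q: "\<And>i. 1 < q $ i"
    and pq: "\<And>i. 1 / q $ i = 1 / p1 $ i + 1 / p2 $ i"
    and [measurable]: "f \<in> borel_measurable lebesgue" "b \<in> borel_measurable lebesgue"
    and R: "0 < R"
    and X: "mixed_lp p1 (\<lambda>x. ennreal (cmod (f x)) * indicator (ball 0 R) x) \<le> ennreal u"
    and Y: "mixed_lp p2 (\<lambda>x. ennreal (cmod (b x - c)) * indicator (ball 0 R) x) \<le> ennreal v"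
    and uv: "0 \<le> u" "0 \<le> v"
  shows set_integrable_mixed_lp: "set_integrable lebesgue (ball 0 R) f"
    and set_integrable_mult_mixed_lp: "set_integrable lebesgue (ball 0 R) (\<lambda>t. f t * b t)"
    and mixed_lp_hardy_comm_shell_le: "mixed_lp q (\<lambda>x. ennreal (cmod (hardy_comm b f x)) * indicator (ball 0 R - ball 0 (R / 2)) x)
      \<le> ennreal (2 * 4 ^ CARD('n) * (u * v))"
proof -
  have pos: "0 < p1 $ i" "0 < q $ i" "1 \<le> q $ i" for i
    using p1[of i] q[of i] by auto
  let ?s1 = "\<Sum>i\<in>UNIV. 1 / p1 $ i" and ?sq = "\<Sum>i\<in>UNIV. 1 / q $ i"
  let ?n = "real CARD('n)"
  let ?F = "\<lambda>x. ennreal (cmod (f x)) * indicator (ball 0 R) x"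
  let ?B = "\<lambda>x. ennreal (cmod (b x - c)) * indicator (ball 0 R) x"
  let ?I = "\<integral>\<^sup>+x. ?F x \<partial>lebesgue"
  let ?J = "\<integral>\<^sup>+t. ennreal (cmod (f t * (b t - c))) * indicator (ball 0 R) t \<partial>lebesgue"
  have "?I \<le> mixed_lp p1 ?F * ennreal ((2 * R) powr (?n - ?s1))"
    by (intro nn_integral_ball_le_mixed_lp p1 R) measurable
  also have "\<dots> \<le> ennreal u * ennreal ((2 * R) powr (?n - ?s1))"
    by (intro mult_right_mono X) auto
  finally have I: "?I \<le> ennreal (u * (2 * R) powr (?n - ?s1))"
    using uv by (simp add: ennreal_mult)
  have prod_eq: "ennreal (cmod (f x * (b x - c))) * indicator (ball 0 R) x = ?F x * ?B x" for x
    by (cases "x \<in> ball 0 R") (simp_all add: norm_mult ennreal_mult)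
  \<comment> \<open>Holder twice: from exponent 1 up to \<open>q\<close> at the cost of a power of
    \<open>R\<close>, then from \<open>q\<close> to the pair \<open>p1\<close>,
    \<open>p2\<close>.\<close>
  have "?J \<le> mixed_lp q (\<lambda>x. ennreal (cmod (f x * (b x - c))) * indicator (ball 0 R) x)
      * ennreal ((2 * R) powr (?n - ?sq))"
    by (intro nn_integral_ball_le_mixed_lp q R) measurable
  also have "mixed_lp q (\<lambda>x. ennreal (cmod (f x * (b x - c))) * indicator (ball 0 R) x)
      = mixed_lp q (\<lambda>x. ?F x * ?B x)"
    by (simp only: prod_eq)
  also have "mixed_lp q (\<lambda>x. ?F x * ?B x) \<le> mixed_lp p1 ?F * mixed_lp p2 ?B"
    by (intro mixed_lp_Holder pos p2 pq) measurable
  also have "\<dots> \<le> ennreal u * ennreal v"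
    by (intro mult_mono X Y) auto
  finally have J: "?J \<le> ennreal (u * v * (2 * R) powr (?n - ?sq))"
    using uv by (simp add: ennreal_mult mult_right_mono)
  show f: "set_integrable lebesgue (ball 0 R) f"
    using I by (subst set_integrable_iff_nn_integral_finite) (auto intro: le_less_trans)
  have "set_integrable lebesgue (ball 0 R) (\<lambda>t. f t * (b t - c))"
    using J by (subst set_integrable_iff_nn_integral_finite) (auto intro: le_less_trans)
  then have "set_integrable lebesgue (ball 0 R) (\<lambda>t. f t * (b t - c) + f t * c)"
    using f by (intro set_integral_add) auto
  then show fb: "set_integrable lebesgue (ball 0 R) (\<lambda>t. f t * b t)"
    by (simp add: algebra_simps)
  \<comment> \<open>Here the indicator of the ball takes the exponent \<open>p1\<close>, since
    \<open>1 / q - 1 / p2 = 1 / p1\<close> in each coordinate.\<close>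
  have "mixed_lp q ?B \<le> mixed_lp p2 ?B * ennreal ((2 * R) powr ?s1)"
    by (intro mixed_lp_times_indicator_ball_le pos p2 R) (use pq in auto)
  also have "\<dots> \<le> ennreal v * ennreal ((2 * R) powr ?s1)"
    by (intro mult_right_mono Y) auto
  finally have B: "mixed_lp q ?B \<le> ennreal (v * (2 * R) powr ?s1)"
    using uv by (simp add: ennreal_mult)
  have ind: "mixed_lp q (indicator (ball 0 R)) \<le> ennreal ((2 * R) powr ?sq)"
    by (intro mixed_lp_indicator_ball_le pos R)
  have "mixed_lp q (\<lambda>x. ennreal (cmod (hardy_comm b f x)) * indicator (ball 0 R - ball 0 (R / 2)) x)
      \<le> mixed_lp q (\<lambda>x. ennreal ((2 / R) ^ CARD('n)) * (?I * ?B x + ?J * indicator (ball 0 R) x))"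
  proof (intro mixed_lp_mono pos)
    fix x
    show "ennreal (cmod (hardy_comm b f x)) * indicator (ball 0 R - ball 0 (R / 2)) x
        \<le> ennreal ((2 / R) ^ CARD('n)) * (?I * ?B x + ?J * indicator (ball 0 R) x)"
    proof (cases "x \<in> ball 0 R - ball 0 (R / 2)")
      case True
      then show ?thesis
        using cmod_hardy_comm_le[OF f fb R, of x c] by (simp add: mult_ac)
    qed simp
  qed
  also have "\<dots> = ennreal ((2 / R) ^ CARD('n)) * mixed_lp q (\<lambda>x. ?I * ?B x + ?J * indicator (ball 0 R) x)"
    by (intro mixed_lp_cmult pos) measurable
  also have "\<dots> \<le> ennreal ((2 / R) ^ CARD('n)) *
      (mixed_lp q (\<lambda>x. ?I * ?B x) + mixed_lp q (\<lambda>x. ?J * indicator (ball 0 R) x))"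
    by (intro mult_left_mono mixed_lp_add_le pos; measurable)
  also have "mixed_lp q (\<lambda>x. ?I * ?B x) = ?I * mixed_lp q ?B"
    by (intro mixed_lp_cmult pos) measurable
  also have "mixed_lp q (\<lambda>x. ?J * indicator (ball 0 R) x) = ?J * mixed_lp q (indicator (ball 0 R))"
    by (intro mixed_lp_cmult pos) measurable
  also have "ennreal ((2 / R) ^ CARD('n)) * (?I * mixed_lp q ?B + ?J * mixed_lp q (indicator (ball 0 R)))
      \<le> ennreal ((2 / R) ^ CARD('n)) *
        (ennreal (u * (2 * R) powr (?n - ?s1)) * ennreal (v * (2 * R) powr ?s1)
          + ennreal (u * v * (2 * R) powr (?n - ?sq)) * ennreal ((2 * R) powr ?sq))"
    by (intro mult_left_mono add_mono mult_mono I J B ind) auto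
  also have "\<dots> = ennreal ((2 / R) ^ CARD('n) *
      (u * (2 * R) powr (?n - ?s1) * (v * (2 * R) powr ?s1) + u * v * (2 * R) powr (?n - ?sq) * (2 * R) powr ?sq))"
    using uv R by (simp flip: ennreal_mult ennreal_plus)
  also have "u * (2 * R) powr (?n - ?s1) * (v * (2 * R) powr ?s1) + u * v * (2 * R) powr (?n - ?sq) * (2 * R) powr ?sq
      = 2 * (u * v) * (2 * R) ^ CARD('n)"
    using R by (simp add: powr_diff powr_realpow)
  also have "(2 / R) ^ CARD('n) * (2 * (u * v) * (2 * R) ^ CARD('n)) = 2 * 4 ^ CARD('n) * (u * v)"
    using R by (simp add: power_divide power_mult_distrib flip: power_mult_distrib[of 2 2])
  finally show "mixed_lp q (\<lambda>x. ennreal (cmod (hardy_comm b f x)) * indicator (ball 0 R - ball 0 (R / 2)) x)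
      \<le> ennreal (2 * 4 ^ CARD('n) * (u * v))" .
qed

section \<open>The weights in the Morrey and CBMO norms\<close>

lemma mixed_norm_times_indicator:
  assumes "\<And>i. 0 < p $ i"
  shows "mixed_norm p (\<lambda>x. g x * indicator A x) = mixed_lp p (\<lambda>x. ennreal (cmod (g x)) * indicator A x)"
proof -
  have "ennreal (cmod (g x * indicator A x)) = ennreal (cmod (g x)) * indicator A x" for x
    by (cases "x \<in> A") simp_all
  then show ?thesis
    by (simp add: mixed_norm_eq_mixed_lp assms)
qed

lemma mixed_norm_indicator:
  assumes "\<And>i. 0 < p $ i"
  shows "mixed_norm p (indicator A) = mixed_lp p (indicator A)"
  using mixed_norm_times_indicator[OF assms, of "\<lambda>_. 1" A] by simp

text \<open>The common denominator of the quotients in \<open>morrey_norm\<close> and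
  \<open>cbmo_norm\<close>.\<close>

definition ball_weight :: "real ^ 'n::{finite,linorder} \<Rightarrow> real \<Rightarrow> real \<Rightarrow> ennreal" where
  "ball_weight p l r = ennreal (measure lebesgue (ball (0 :: (real, 'n) vec) r) powr l)
     * mixed_norm p (indicator (ball 0 r))"

lemma measure_ball_powr:
  fixes r l :: real
  assumes "0 < r"
  shows "measure lebesgue (ball (0 :: real ^ 'n::finite) r) powr l
    = unit_ball_vol CARD('n) powr l * r powr (CARD('n) * l)"
proof -
  have "measure lebesgue (ball (0 :: real ^ 'n) r) = unit_ball_vol CARD('n) * r powr CARD('n)"
    using assms content_ball[of r "0 :: real ^ 'n"] by (simp add: powr_realpow)
  then show ?thesis
    using assms by (simp add: powr_mult powr_powr)
qed

text \<open>Together with the matching lower bound this makes the weight comparable to a pure power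
  of \<open>r\<close>. The upper bound serves to exploit the norms of \<open>f\<close> and
  \<open>b\<close>, the lower one to bound the norm of the commutator.\<close>

lemma ball_weight_le:
  fixes p :: "real ^ 'n::{finite,linorder}" and l :: real
  assumes "\<And>i. 0 < p $ i" "0 < r"
  shows "ball_weight p l r \<le> ennreal (unit_ball_vol CARD('n) powr l * 2 powr (\<Sum>i\<in>UNIV. 1 / p $ i)
    * r powr (CARD('n) * l + (\<Sum>i\<in>UNIV. 1 / p $ i)))"
proof -
  have "ball_weight p l r \<le> ennreal (unit_ball_vol CARD('n) powr l * r powr (CARD('n) * l))
      * ennreal ((2 * r) powr (\<Sum>i\<in>UNIV. 1 / p $ i))"
    unfolding ball_weight_def measure_ball_powr[OF assms(2)] mixed_norm_indicator[OF assms(1)]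
    by (intro mult_left_mono mixed_lp_indicator_ball_le assms) auto
  also have "\<dots> = ennreal (unit_ball_vol CARD('n) powr l * 2 powr (\<Sum>i\<in>UNIV. 1 / p $ i)
    * r powr (CARD('n) * l + (\<Sum>i\<in>UNIV. 1 / p $ i)))"
    using assms(2) by (simp add: powr_mult powr_add mult_ac flip: ennreal_mult)
  finally show ?thesis .
qed

lemma ball_weight_ge:
  fixes p :: "real ^ 'n::{finite,linorder}" and l :: real
  assumes "\<And>i. 0 < p $ i" "0 < r"
  shows "ennreal (unit_ball_vol CARD('n) powr l * (1 / CARD('n)) powr (\<Sum>i\<in>UNIV. 1 / p $ i)
    * r powr (CARD('n) * l + (\<Sum>i\<in>UNIV. 1 / p $ i))) \<le> ball_weight p l r"
proof -
  have "ennreal (unit_ball_vol CARD('n) powr l * (1 / CARD('n)) powr (\<Sum>i\<in>UNIV. 1 / p $ i)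
      * r powr (CARD('n) * l + (\<Sum>i\<in>UNIV. 1 / p $ i)))
      = ennreal (unit_ball_vol CARD('n) powr l * r powr (CARD('n) * l))
      * ennreal ((r / CARD('n)) powr (\<Sum>i\<in>UNIV. 1 / p $ i))"
    using assms(2) by (simp add: powr_divide powr_add mult_ac flip: ennreal_mult)
  also have "\<dots> \<le> ball_weight p l r"
    unfolding ball_weight_def measure_ball_powr[OF assms(2)] mixed_norm_indicator[OF assms(1)]
    by (intro mult_left_mono mixed_lp_indicator_ball_ge assms) auto
  finally show ?thesis .
qed

text \<open>The weight is positive and finite, so the extended quotient can be multiplied
  out.\<close>

lemma le_SUP_ball_weight:
  fixes p :: "real ^ 'n::{finite,linorder}" and l :: real
  assumes "\<And>i. 0 < p $ i" "0 < r" and A: "(SUP r\<in>{0<..}. A r / ball_weight p l r) \<le> ennreal m" and "0 \<le> m"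
  shows "A r \<le> ennreal (m * (unit_ball_vol CARD('n) powr l * 2 powr (\<Sum>i\<in>UNIV. 1 / p $ i)
    * r powr (CARD('n) * l + (\<Sum>i\<in>UNIV. 1 / p $ i))))"
proof -
  have vol: "0 < unit_ball_vol (CARD('n))"
    by simp
  have "0 < unit_ball_vol CARD('n) powr l * (1 / CARD('n)) powr (\<Sum>i\<in>UNIV. 1 / p $ i)
    * r powr (CARD('n) * l + (\<Sum>i\<in>UNIV. 1 / p $ i))"
    using vol assms(2) by (intro mult_pos_pos) (auto simp del: unit_ball_vol_pos)
  then have pos: "0 < ball_weight p l r"
    using ball_weight_ge[of p r l] assms by (meson ennreal_less_zero_iff less_le_trans)
  have fin: "ball_weight p l r < \<infinity>"
    using ball_weight_le[of p r l] assms by (auto intro: le_less_trans)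
  have "A r / ball_weight p l r \<le> (SUP r\<in>{0<..}. A r / ball_weight p l r)"
    using assms(2) by (intro SUP_upper) auto
  with A have *: "A r / ball_weight p l r \<le> ennreal m"
    by (rule order_trans[rotated])
  have "A r = A r / ball_weight p l r * ball_weight p l r"
    using pos fin by (simp add: ennreal_divide_times)
  also have "\<dots> \<le> ennreal m * ennreal (unit_ball_vol CARD('n) powr l * 2 powr (\<Sum>i\<in>UNIV. 1 / p $ i)
    * r powr (CARD('n) * l + (\<Sum>i\<in>UNIV. 1 / p $ i)))"
    by (intro mult_mono * ball_weight_le assms) auto
  finally show ?thesis
    using assms(4) by (simp add: ennreal_mult)
qed

section \<open>Summation over the dyadic shells\<close>

lemma ex_dyadic_shell:
  fixes t r :: real
  assumes "0 < t" "t < r"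
  shows "\<exists>k. r / 2 ^ Suc k \<le> t \<and> t < r / 2 ^ k"
proof -
  obtain k where k: "(1 / 2) ^ k < t / r"
    using real_arch_pow_inv[of "t / r" "1 / 2"] assms by auto
  then have ex: "r / 2 ^ k \<le> t"
    using assms by (simp add: power_divide field_simps)
  \<comment> \<open>The first dyadic radius not exceeding \<open>t\<close>; it is not
    \<open>r\<close> itself, so it has a predecessor, which lies above \<open>t\<close>.\<close>
  define m where "m = (LEAST k. r / 2 ^ k \<le> t)"
  have m: "r / 2 ^ m \<le> t"
    unfolding m_def by (rule LeastI[where P="\<lambda>k. r / 2 ^ k \<le> t"]) (rule ex)
  have "m \<noteq> 0"
    using m assms by (intro notI) simp
  then obtain j where j: "m = Suc j"
    using not0_implies_Suc by blast
  have "\<not> r / 2 ^ j \<le> t"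
    by (rule not_less_Least[where P="\<lambda>k. r / 2 ^ k \<le> t"]) (simp add: j flip: m_def)
  with m j show ?thesis
    by (intro exI[of _ j]) auto
qed

lemma hardy_comm_0 [simp]: "hardy_comm b f 0 = 0"
  by (simp add: hardy_comm_def hardy_def)

text \<open>The shell with outer radius \<open>r / 2 ^ k\<close> contributes at most a constant
  times the k-th power of \<open>2 powr - (e1 + e2)\<close>; the geometric series yields the
  denominator. The centre \<open>c R\<close> may change from shell to shell.\<close>

lemma mixed_lp_hardy_comm_ball_le:
  fixes p1 p2 q :: "real ^ 'n::{finite,linorder}" and f b :: "real ^ 'n::{finite,linorder} \<Rightarrow> complex"
  assumes p1: "\<And>i. 1 < p1 $ i" and p2: "\<And>i. 0 < p2 $ i" and q: "\<And>i. 1 < q $ i"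
    and pq: "\<And>i. 1 / q $ i = 1 / p1 $ i + 1 / p2 $ i"
    and meas: "f \<in> borel_measurable lebesgue" "b \<in> borel_measurable lebesgue"
    and X: "\<And>R. 0 < R \<Longrightarrow> mixed_lp p1 (\<lambda>x. ennreal (cmod (f x)) * indicator (ball 0 R) x)
      \<le> ennreal (u * R powr e1)"
    and Y: "\<And>R. 0 < R \<Longrightarrow> mixed_lp p2 (\<lambda>x. ennreal (cmod (b x - c R)) * indicator (ball 0 R) x)
      \<le> ennreal (v * R powr e2)"
    and uv: "0 \<le> u" "0 \<le> v" and e: "0 < e1 + e2" and r: "0 < r"
  shows "mixed_lp q (\<lambda>x. ennreal (cmod (hardy_comm b f x)) * indicator (ball 0 r) x)
    \<le> ennreal (2 * 4 ^ CARD('n) / (1 - 2 powr - (e1 + e2)) * (u * v) * r powr (e1 + e2))"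
proof -
  have pos: "0 < q $ i" "1 \<le> q $ i" for i
    using q[of i] by auto
  note [measurable] = borel_measurable_hardy_comm[OF meas]
  define g where "g k x = ennreal (cmod (hardy_comm b f x))
    * indicator (ball 0 (r / 2 ^ k) - ball 0 (r / 2 ^ k / 2)) x" for k :: nat and x
  have [measurable]: "g k \<in> borel_measurable lebesgue" for k
    unfolding g_def by measurable
  let ?z = "2 powr - (e1 + e2)"
  let ?K = "2 * 4 ^ CARD('n) * (u * v) * r powr (e1 + e2)"
  have z: "0 \<le> ?z" "?z < 1"
    using e powr_less_mono[of "- (e1 + e2)" 0 2] by auto
  have gk: "mixed_lp q (g k) \<le> ennreal (?K * ?z ^ k)" for k
  proof -
    have R: "0 < r / 2 ^ k"
      using r by simp
    have "mixed_lp q (g k) \<le> ennreal (2 * 4 ^ CARD('n) * (u * (r / 2 ^ k) powr e1 * (v * (r / 2 ^ k) powr e2)))"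
      unfolding g_def
      by (rule mixed_lp_hardy_comm_shell_le[OF p1 p2 q pq meas R X[OF R] Y[OF R]]) (use uv in auto)
    also have "u * (r / 2 ^ k) powr e1 * (v * (r / 2 ^ k) powr e2) = u * v * (r / 2 ^ k) powr (e1 + e2)"
      by (simp add: powr_add)
    also have "(r / 2 ^ k) powr (e1 + e2) = r powr (e1 + e2) * ?z ^ k"
    proof -
      have "(r / 2 ^ k) powr (e1 + e2) = r powr (e1 + e2) / (2 powr k) powr (e1 + e2)"
        using r by (simp add: powr_divide powr_realpow)
      also have "\<dots> = r powr (e1 + e2) * ?z powr k"
        by (simp add: powr_powr divide_inverse algebra_simps flip: powr_minus)
      finally show ?thesis
        by (simp add: powr_realpow)
    qed
    finally show ?thesis
      by (simp add: mult_ac)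
  qed
  have "mixed_lp q (\<lambda>x. ennreal (cmod (hardy_comm b f x)) * indicator (ball 0 r) x)
      \<le> mixed_lp q (\<lambda>x. \<Sum>k. g k x)"
  proof (intro mixed_lp_mono pos)
    fix x
    show "ennreal (cmod (hardy_comm b f x)) * indicator (ball 0 r) x \<le> (\<Sum>k. g k x)"
    \<comment> \<open>The origin lies in no shell, but the commutator is 0 there.\<close>
    proof (cases "x = 0 \<or> x \<notin> ball 0 r")
      case False
      then obtain k where "r / 2 ^ Suc k \<le> norm x" "norm x < r / 2 ^ k"
        using ex_dyadic_shell[of "norm x" r] by auto
      then have "ennreal (cmod (hardy_comm b f x)) * indicator (ball 0 r) x = g k x"
        using False by (simp add: g_def mult.commute)
      also have "\<dots> \<le> (\<Sum>k. g k x)"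
        using sum_le_suminf[of "\<lambda>k. g k x" "{k}"] by simp
      finally show ?thesis .
    qed auto
  qed
  also have "\<dots> \<le> (\<Sum>k. mixed_lp q (g k))"
    by (intro mixed_lp_suminf_le pos) measurable
  also have "\<dots> \<le> (\<Sum>k. ennreal (?K * ?z ^ k))"
    by (intro suminf_le gk) auto
  also have "\<dots> = ennreal (\<Sum>k. ?K * ?z ^ k)"
    using uv z by (intro suminf_ennreal2 summable_mult summable_geometric) auto
  also have "(\<Sum>k. ?K * ?z ^ k) = ?K * (1 / (1 - ?z))"
    using z by (subst suminf_mult) (auto simp: suminf_geometric intro!: summable_geometric)
  finally show ?thesis
    by simp
qed

theorem theorem4p1:
  fixes p1 p2 q :: "real ^ 'n::{finite,linorder}"
    and l l1 l2 :: real
  assumes "\<And>i. 1 < p1 $ i"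
    and "\<And>i. 1 < q $ i"
    and "\<And>i. p1 $ i / (p1 $ i - 1) < p2 $ i"
    and "\<And>i. 1 / q $ i = 1 / p1 $ i + 1 / p2 $ i"
    and "- (1 / real CARD('n)) * (\<Sum>i\<in>UNIV. 1 / q $ i) < l" and "l < 0"
    and "0 \<le> l2" and "l2 < 1 / real CARD('n)"
    and "l = l1 + l2"
  shows "\<exists>C>0. \<forall>b \<in> cbmo p2 l2. \<forall>f \<in> morrey p1 l1.
           hardy_defined f \<and> hardy_defined (\<lambda>t. f t * b t) \<and>
           hardy_comm b f \<in> morrey q l \<and>
           morrey_norm q l (hardy_comm b f)
             \<le> ennreal C * cbmo_norm p2 l2 b * morrey_norm p1 l1 f"
proof -
  have p1: "0 < p1 $ i" and q: "0 < q $ i" for i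
    using assms(1,2)[of i] by auto
  have p2: "0 < p2 $ i" for i
  proof -
    have "0 < p1 $ i / (p1 $ i - 1)"
      using assms(1)[of i] by simp
    with assms(3)[of i] show ?thesis
      by simp
  qed
  let ?n = "real CARD('n)" and ?V = "unit_ball_vol (real CARD('n))"
  define s1 s2 s where "s1 = (\<Sum>i\<in>UNIV. 1 / p1 $ i)" and "s2 = (\<Sum>i\<in>UNIV. 1 / p2 $ i)"
    and "s = (\<Sum>i\<in>UNIV. 1 / q $ i)"
  have s: "s = s1 + s2"
    unfolding s_def s1_def s2_def assms(4) by (simp add: sum.distrib)
  have e: "?n * l1 + s1 + (?n * l2 + s2) = ?n * l + s"
    by (simp add: s assms(9) algebra_simps)
  \<comment> \<open>The lower bound on \<open>l\<close>, multiplied by the dimension: it makes the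
    ratio of the geometric series smaller than 1.\<close>
  have epos: "0 < ?n * l + s"
    using assms(5) by (simp add: field_simps flip: s_def)
  have V: "0 < ?V powr a" for a
    using unit_ball_vol_pos[of ?n] by (simp only: powr_gt_zero) linarith
  define K1 K2 K3 where "K1 = ?V powr l1 * 2 powr s1" and "K2 = ?V powr l2 * 2 powr s2"
    and "K3 = ?V powr l * (1 / ?n) powr s"
  have K: "0 < K1" "0 < K2" "0 < K3"
    unfolding K1_def K2_def K3_def by (intro mult_pos_pos V; simp)+
  define A where "A = 2 * 4 ^ CARD('n) / (1 - 2 powr - (?n * l + s))"
  have "2 powr - (?n * l + s) < 2 powr 0"
    using epos by (intro powr_less_mono) auto
  then have A: "0 < A"
    by (simp add: A_def)
  \<comment> \<open>\<open>A\<close> comes from the summed shells, \<open>K1\<close> and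
    \<open>K2\<close> from the upper bounds for the weights of \<open>f\<close> and
    \<open>b\<close>, and \<open>K3\<close> from the lower bound for the target weight. All are
    fixed before \<open>b\<close> and \<open>f\<close> are chosen.\<close>
  define C where "C = A * K1 * K2 / K3"
  have C: "0 < C"
    using A K by (simp add: C_def)
  have main: "hardy_defined f \<and> hardy_defined (\<lambda>t. f t * b t) \<and>
      hardy_comm b f \<in> morrey q l \<and>
      morrey_norm q l (hardy_comm b f) \<le> ennreal C * cbmo_norm p2 l2 b * morrey_norm p1 l1 f"
    if b: "b \<in> cbmo p2 l2" and f: "f \<in> morrey p1 l1" for b f
  proof -
    have meas: "f \<in> borel_measurable lebesgue" "b \<in> borel_measurable lebesgue"
      using b f by (auto simp: cbmo_def morrey_def)
    obtain m where m: "morrey_norm p1 l1 f = ennreal m" "0 \<le> m"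
      using f by (cases "morrey_norm p1 l1 f") (auto simp: morrey_def)
    obtain k where k: "cbmo_norm p2 l2 b = ennreal k" "0 \<le> k"
      using b by (cases "cbmo_norm p2 l2 b") (auto simp: cbmo_def)
    have X: "mixed_lp p1 (\<lambda>x. ennreal (cmod (f x)) * indicator (ball 0 R) x)
        \<le> ennreal (m * K1 * R powr (?n * l1 + s1))" if "0 < R" for R
    proof -
      have "mixed_norm p1 (\<lambda>x. f x * indicator (ball 0 R) x) \<le> ennreal (m * (K1 * R powr (?n * l1 + s1)))"
        unfolding K1_def s1_def
        by (rule le_SUP_ball_weight[OF p1 that,
              where A="\<lambda>R. mixed_norm p1 (\<lambda>x. f x * indicator (ball 0 R) x)"])
          (use m in \<open>auto simp: morrey_norm_def ball_weight_def\<close>)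
      then show ?thesis
        by (simp add: mixed_norm_times_indicator[OF p1] mult.assoc)
    qed
    have Y: "mixed_lp p2 (\<lambda>x. ennreal (cmod (b x - ball_mean R b)) * indicator (ball 0 R) x)
        \<le> ennreal (k * K2 * R powr (?n * l2 + s2))" if "0 < R" for R
    proof -
      have "mixed_norm p2 (\<lambda>x. (b x - ball_mean R b) * indicator (ball 0 R) x)
          \<le> ennreal (k * (K2 * R powr (?n * l2 + s2)))"
        unfolding K2_def s2_def
        by (rule le_SUP_ball_weight[OF p2 that,
              where A="\<lambda>R. mixed_norm p2 (\<lambda>x. (b x - ball_mean R b) * indicator (ball 0 R) x)"])
          (use k in \<open>auto simp: cbmo_norm_def ball_weight_def\<close>)
      then show ?thesis
        by (simp add: mixed_norm_times_indicator[OF p2] mult.assoc)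
    qed
    have nonneg: "0 \<le> m * K1" "0 \<le> k * K2"
      using m k K by auto
    have int: "set_integrable lebesgue (ball 0 R) f" "set_integrable lebesgue (ball 0 R) (\<lambda>t. f t * b t)"
      if "0 < R" for R
      by (rule set_integrable_mixed_lp[OF assms(1) p2 assms(2,4) meas that X[OF that] Y[OF that]]
            set_integrable_mult_mixed_lp[OF assms(1) p2 assms(2,4) meas that X[OF that] Y[OF that]],
          use nonneg in auto)+
    have defd: "hardy_defined f" "hardy_defined (\<lambda>t. f t * b t)"
      unfolding hardy_defined_def
    proof (safe)
      fix x :: "(real, 'n) vec"
      \<comment> \<open>At the origin the ball has radius 0, while \<open>int\<close> asks for a
        positive radius, so a larger ball is used.\<close>
      have "0 < norm x + 1"
        using norm_ge_zero[of x] by linarith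
      note int = int[OF this]
      show "set_integrable lebesgue (ball 0 (norm x)) f"
        by (rule set_integrable_subset[OF int(1)]) auto
      show "set_integrable lebesgue (ball 0 (norm x)) (\<lambda>t. f t * b t)"
        by (rule set_integrable_subset[OF int(2)]) auto
    qed
    have quot: "mixed_norm q (\<lambda>x. hardy_comm b f x * indicator (ball 0 r) x) / ball_weight q l r
        \<le> ennreal (C * k * m)" if r: "0 < r" for r
    proof -
      have "mixed_norm q (\<lambda>x. hardy_comm b f x * indicator (ball 0 r) x)
          \<le> ennreal (A * (m * K1 * (k * K2)) * r powr (?n * l + s))"
        unfolding mixed_norm_times_indicator[OF q] A_def e[symmetric]
        by (rule mixed_lp_hardy_comm_ball_le[OF assms(1) p2 assms(2,4) meas X Y nonneg _ r])
           (use epos e in auto)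
      \<comment> \<open>The same power of \<open>r\<close> occurs in the target weight, so it
        cancels in the quotient and the bound is uniform in \<open>r\<close>.\<close>
      also have "A * (m * K1 * (k * K2)) * r powr (?n * l + s) = C * k * m * (K3 * r powr (?n * l + s))"
        using K by (simp add: C_def)
      also have "ennreal (C * k * m * (K3 * r powr (?n * l + s)))
          = ennreal (C * k * m) * ennreal (K3 * r powr (?n * l + s))"
        using C K m k by (intro ennreal_mult) auto
      also have "\<dots> \<le> ennreal (C * k * m) * ball_weight q l r"
        unfolding K3_def s_def by (intro mult_left_mono ball_weight_ge q r) auto
      finally have *: "mixed_norm q (\<lambda>x. hardy_comm b f x * indicator (ball 0 r) x)
          \<le> ennreal (C * k * m) * ball_weight q l r" .
      have "0 < ennreal (K3 * r powr (?n * l + s))"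
        using K r by simp
      also have "\<dots> \<le> ball_weight q l r"
        unfolding K3_def s_def by (intro ball_weight_ge q r)
      finally show ?thesis
        using * by (intro divide_le_posI_ennreal) (simp_all add: mult.commute)
    qed
    have le: "morrey_norm q l (hardy_comm b f) \<le> ennreal (C * k * m)"
      unfolding morrey_norm_def ball_weight_def[symmetric] by (intro SUP_least quot) auto
    then have "hardy_comm b f \<in> morrey q l"
      using borel_measurable_hardy_comm[OF meas] by (auto simp: morrey_def intro: le_less_trans)
    moreover have "ennreal (C * k * m) = ennreal C * cbmo_norm p2 l2 b * morrey_norm p1 l1 f"
      using C m k by (simp add: ennreal_mult)
    ultimately show ?thesis
      using defd le by simp
  qed
  then show ?thesis
    using C by blast
qed

end
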